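(* Let $\Sigma$ be a finite alphabet with a special symbol $0 \in \Sigma$, and let $X \subset \Sigma^{\mathbb{Z}^2}$ be a block-gluing subshift of finite type containing the point $0^{\mathbb{Z}^2}$. Then $X$ is nil-rigid; that is, every asymptotically nilpotent endomorphism (cellular automaton) $f : X \to X$ is nilpotent.
   Context: $\Sigma^{\mathbb{Z}^2}$ carries the product topology and the shift action $(\vec{g}\cdot x)_{\vec{h}}=x_{\vec{h}-\vec{g}}$. A subshift is a closed shift-invariant subset $X\subset\Sigma^{\mathbb{Z}^2}$. It is of finite type (SFT) if there is a clopen set $C\subset\Sigma^{\mathbb{Z}^2}$ such that $x\in X$ if and only if $\vec g\cdot x\in C$ for all $\vec g\in\mathbb{Z}^2$ (equivalently, $X$ is defined by finitely many forbidden finite patterns). $0^{\mathbb{Z}^2}$ is the configuration with every coordinate equal to $0$. For $A\subseteq\mathbb{Z}^2$, a pattern $P\in\Sigma^A$ is valid in $X$ if $P=x|_A$ for some $x\in X$. Let $\mathcal{B}$ be the closure, under pointwise convergence of subsets of $\mathbb{Z}^2$, of the family of all translates of the rectangles $[0,m-1]\times[0,n-1]$. Let $d$ be the $\ell_\infty$ metric on $\mathbb{Z}^2$ and $d(A,B)=\min_{a\in A,b\in B}d(a,b)$. $X$ is block-gluing if there is $R\in\mathbb{N}$ such that whenever $A,B\in\mathcal{B}$, $d(A,B)\ge R$, and $P\in\Sigma^A$, $Q\in\Sigma^B$ are valid in $X$, the union pattern on $A\cup B$ that agrees with $P$ on $A$ and with $Q$ on $B$ is valid in $X$. An endomorphism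 (cellular automaton) of $X$ is a continuous shift-commuting map $f:X\to X$ with $f(0^{\mathbb{Z}^2})=0^{\mathbb{Z}^2}$. It is asymptotically nilpotent if $f^n(x)\to 0^{\mathbb{Z}^2}$ as $n\to\infty$ for all $x\in X$, and nilpotent if $f^n(X)=\{0^{\mathbb{Z}^2}\}$ for some $n\in\mathbb{N}$. *)

theory Defs
  imports "HOL-Analysis.Analysis" "HOL-Library.Extended_Nat"
begin

type_synonym 'a config = "int \<times> int \<Rightarrow> 'a"

definition config_topology :: "'a set \<Rightarrow> 'a config topology" where
  "config_topology \<Sigma> = product_topology (\<lambda>_. discrete_topology \<Sigma>) UNIV"

definition shift_by :: "int \<times> int \<Rightarrow> 'a config \<Rightarrow> 'a config" where
  "shift_by g x = (\<lambda>h. x (h - g))"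

definition subshift :: "'a set \<Rightarrow> 'a config set \<Rightarrow> bool" where
  "subshift \<Sigma> X \<longleftrightarrow>
     closedin (config_topology \<Sigma>) X \<and> (\<forall>g. \<forall>x\<in>X. shift_by g x \<in> X)"

definition finite_type :: "'a set \<Rightarrow> 'a config set \<Rightarrow> bool" where
  "finite_type \<Sigma> X \<longleftrightarrow>
     (\<exists>C. openin (config_topology \<Sigma>) C \<and> closedin (config_topology \<Sigma>) C \<and>
          (\<forall>x \<in> topspace (config_topology \<Sigma>). x \<in> X \<longleftrightarrow> (\<forall>g. shift_by g x \<in> C)))"

text \<open>A pattern on \<open>A\<close> is an extensional function in \<open>A \<rightarrow>\<^sub>E \<Sigma>\<close>.\<close>

definition valid_pattern :: "'a config set \<Rightarrow> (int \<times> int) set \<Rightarrow> 'a config \<Rightarrow> bool" where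
  "valid_pattern X A P \<longleftrightarrow> (\<exists>x\<in>X. P = restrict x A)"

text \<open>If \<open>A\<close> and \<open>B\<close> overlap, \<open>P\<close> takes precedence; this case can only matter for gluing
  distance \<open>0\<close>.\<close>

definition union_pattern ::
    "(int \<times> int) set \<Rightarrow> 'a config \<Rightarrow> (int \<times> int) set \<Rightarrow> 'a config \<Rightarrow> 'a config" where
  "union_pattern A P B Q = restrict (\<lambda>h. if h \<in> A then P h else Q h) (A \<union> B)"

definition rectangle_translates :: "(int \<times> int) set set" where
  "rectangle_translates =
     {(+) g ` ({0..int m - 1} \<times> {0..int n - 1}) | g m n. True}"

text \<open>Subsets of the grid are identified with their characteristic functions, so that pointwise
  convergence of sets is convergence in \<open>config_topology (UNIV :: bool set)\<close>.  The closure contains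
  the empty set, and also quadrants, strips, half-planes and the whole plane.\<close>

definition blocks :: "(int \<times> int) set set" where
  "blocks =
     {A. (\<lambda>h. h \<in> A) \<in>
           config_topology (UNIV :: bool set) closure_of ((\<lambda>S h. h \<in> S) ` rectangle_translates)}"

definition linf_dist :: "int \<times> int \<Rightarrow> int \<times> int \<Rightarrow> nat" where
  "linf_dist a b = nat (max \<bar>fst a - fst b\<bar> \<bar>snd a - snd b\<bar>)"

text \<open>The infimum is a minimum when both sets are nonempty, and \<open>\<infinity>\<close> otherwise.\<close>

definition linf_setdist :: "(int \<times> int) set \<Rightarrow> (int \<times> int) set \<Rightarrow> enat" where
  "linf_setdist A B = (INF a\<in>A. INF b\<in>B. enat (linf_dist a b))"

definition block_gluing :: "'a set \<Rightarrow> 'a config set \<Rightarrow> bool" where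
  "block_gluing \<Sigma> X \<longleftrightarrow>
     (\<exists>R::nat. \<forall>A\<in>blocks. \<forall>B\<in>blocks. enat R \<le> linf_setdist A B \<longrightarrow>
        (\<forall>P \<in> A \<rightarrow>\<^sub>E \<Sigma>. \<forall>Q \<in> B \<rightarrow>\<^sub>E \<Sigma>. valid_pattern X A P \<longrightarrow> valid_pattern X B Q \<longrightarrow>
           valid_pattern X (A \<union> B) (union_pattern A P B Q)))"

text \<open>An endomorphism of \<open>X\<close> is a total HOL function; only its values on \<open>X\<close> are relevant.\<close>

definition endomorphism :: "'a set \<Rightarrow> 'a \<Rightarrow> 'a config set \<Rightarrow> ('a config \<Rightarrow> 'a config) \<Rightarrow> bool" where
  "endomorphism \<Sigma> z X f \<longleftrightarrow>
     continuous_map (subtopology (config_topology \<Sigma>) X) (subtopology (config_topology \<Sigma>) X) f \<and>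
     (\<forall>g. \<forall>x\<in>X. f (shift_by g x) = shift_by g (f x)) \<and>
     f (\<lambda>_. z) = (\<lambda>_. z)"

definition asymptotically_nilpotent ::
    "'a set \<Rightarrow> 'a \<Rightarrow> 'a config set \<Rightarrow> ('a config \<Rightarrow> 'a config) \<Rightarrow> bool" where
  "asymptotically_nilpotent \<Sigma> z X f \<longleftrightarrow>
     (\<forall>x\<in>X. limitin (config_topology \<Sigma>) (\<lambda>n. (f ^^ n) x) (\<lambda>_. z) sequentially)"

definition nilpotent_on :: "'a \<Rightarrow> 'a config set \<Rightarrow> ('a config \<Rightarrow> 'a config) \<Rightarrow> bool" where
  "nilpotent_on z X f \<longleftrightarrow> (\<exists>n::nat. (f ^^ n) ` X = {\<lambda>_. z})"

definition nil_rigid :: "'a set \<Rightarrow> 'a \<Rightarrow> 'a config set \<Rightarrow> bool" where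
  "nil_rigid \<Sigma> z X \<longleftrightarrow>
     (\<forall>f. endomorphism \<Sigma> z X f \<and> asymptotically_nilpotent \<Sigma> z X f \<longrightarrow> nilpotent_on z X f)"

end

theory Submission
  imports Defs
begin

text \<open>Write \<open>0\<close> for the symbol \<open>z\<close>, and call a configuration mortal if finitely many iterations of the automaton
\<open>f\<close> turn it into the zero configuration.  Let \<open>r\<close> bound both the radius of \<open>f\<close> and the size of the windows
that define the shift of finite type \<open>X\<close>.  Because \<open>X\<close> is of finite type, a configuration that is zero along
a thick enough seam may be cut there, one side being replaced by zeros, and configurations whose supports
are far apart may be superposed.

The engine is a diagonal construction (\<open>no_recurrent_extension\<close>): if every member of a family can be changed
arbitrarily far out so that a fixed finite window is again nonzero at some late time, then infinitely many
changes produce a point whose orbit is nonzero in that window infinitely often, against asymptotic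
nilpotency.  Its first consequence (\<open>no_mortal_spreading\<close>) is that mortal bounded configurations cannot reach
a fixed window from arbitrarily far away: once one such configuration is dead, it no longer disturbs the
next one, so they could be stacked around the window.  Its second consequence is the existence of walls:
patterns that force a window to be zero from some time on.

Walls separate in dimension one only.  Hence consider configurations that are vertically periodic and
supported in finitely many columns.  If such a \<open>u\<close> is not mortal, then it spreads horizontally without
bound, so a translate of \<open>u\<close> is zero on many columns and still reaches the central one.  Place walls far
away on both sides, wait until they are zero, and cut there.  What remains between the walls is confined,
hence mortal, and it still reaches the centre from far away, which is impossible.  So \<open>u\<close> is mortal
(\<open>vperiodic_mortal\<close>).  Consequently points of finite support are mortal (\<open>finite_support_mortal\<close>): if one
of them spread horizontally without bound, its vertical periodisations would be mortal and spread
arbitrarily far; the vertical direction is symmetric.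

Block gluing provides points of finite support.  Gluing zero half-planes around a large
square cut from a point of \<open>X\<close> leaves unknown symbols in a frame, two strips of which are infinite
but of bounded height.  By the pigeonhole principle these strips can be made eventually periodic with a period
independent of the square, and there are only finitely many periodic strips of that height and period, all of them
mortal.  So after a number \<open>N\<close> of steps that does not depend on the square the support is finite
(\<open>finite_support_approximation\<close>).

Finally, by \<open>no_mortal_spreading\<close> there is a square \<open>B\<close> such that points of finite support that are zero on
\<open>B\<close> never reach its centre.  If \<open>f\<close> were not nilpotent, there would be points of finite support that are
nonzero at the origin at arbitrarily late times, hence nonzero somewhere in \<open>B\<close> at all earlier times,
and a compactness argument would give a single point whose orbit never vanishes on \<open>B\<close>.\<close>

section \<open>Geometry of the grid\<close>

definition near :: "int \<Rightarrow> int \<times> int \<Rightarrow> int \<times> int \<Rightarrow> bool" where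
  "near k g h \<longleftrightarrow> \<bar>fst h - fst g\<bar> \<le> k \<and> \<bar>snd h - snd g\<bar> \<le> k"

lemma near_trans: "near k g h \<Longrightarrow> near l h i \<Longrightarrow> near (k + l) g i"
  by (auto simp: near_def)

text \<open>Columns and squares around the origin are both sublevel sets of a gauge \<open>\<nu>\<close> that changes by at most the
distance moved, so one superposition argument serves for both.\<close>

definition lipschitz :: "(int \<times> int \<Rightarrow> int) \<Rightarrow> bool" where
  "lipschitz \<nu> \<longleftrightarrow> (\<forall>k g h. near k g h \<longrightarrow> \<bar>\<nu> h - \<nu> g\<bar> \<le> k)"

lemma lipschitzD: "lipschitz \<nu> \<Longrightarrow> near k g h \<Longrightarrow> \<bar>\<nu> h - \<nu> g\<bar> \<le> k"
  unfolding lipschitz_def by blast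

lemma lipschitz_fst: "lipschitz (\<lambda>h. \<bar>fst h\<bar>)"
  by (auto simp: lipschitz_def near_def)

lemma lipschitz_max: "lipschitz (\<lambda>h. max \<bar>fst h\<bar> \<bar>snd h\<bar>)"
  by (auto simp: lipschitz_def near_def max_def)

definition vperiodic :: "int \<Rightarrow> (int \<times> int \<Rightarrow> 'a) \<Rightarrow> bool" where
  "vperiodic q x \<longleftrightarrow> shift_by (0, q) x = x"

lemma vperiodicD:
  assumes "vperiodic q x"
  shows "x (i, j + k * q) = x (i, j)"
proof -
  have one: "x (i, j) = x (i, j - q)" for j
  proof -
    have "shift_by (0, q) x (i, j) = x (i, j)" using assms by (simp add: vperiodic_def)
    then show ?thesis by (simp add: shift_by_def)
  qed
  show ?thesis
  proof (induction k rule: int_induct[where k = 0])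
    case (step1 k)
    then show ?case using one[of "j + (k + 1) * q"] by (simp add: algebra_simps)
  next
    case (step2 k)
    then show ?case using one[of "j + k * q"] by (simp add: algebra_simps)
  qed simp
qed

lemma vperiodic_mod: "vperiodic q x \<Longrightarrow> x (i, j) = x (i, j mod q)"
  using vperiodicD[of q x i "j mod q" "j div q"] by (simp add: algebra_simps)

lemma vperiodic_shift: "vperiodic q x \<Longrightarrow> vperiodic q (shift_by g x)"
  unfolding vperiodic_def shift_by_def fun_eq_iff by (metis diff_diff_add add.commute)

text \<open>The representative of \<open>j\<close> modulo \<open>2 * H\<close> in the interval from \<open>- H\<close> to \<open>H\<close>, right end excluded: it is the
identity near the origin, so that periodising leaves the middle of a configuration in place.\<close>

definition wrap :: "int \<Rightarrow> int \<Rightarrow> int" where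
  "wrap H j = (j + H) mod (2 * H) - H"

lemma wrap_eqI:
  assumes "m = w + c * (2 * H)" "- H \<le> w" "w < H"
  shows "wrap H m = w"
proof -
  have "(m + H) mod (2 * H) = (w + H) mod (2 * H)"
    using mod_mult_self1[of "w + H" c "2 * H"] assms(1) by (simp add: algebra_simps)
  then show ?thesis using assms(2,3) by (simp add: wrap_def)
qed

lemma wrap_bounds: "0 < H \<Longrightarrow> - H \<le> wrap H j \<and> wrap H j < H"
  using pos_mod_bound[of "2 * H" "j + H"] pos_mod_sign[of "2 * H" "j + H"] by (simp add: wrap_def)

lemma wrap_decomp: "j = wrap H j + ((j + H) div (2 * H)) * (2 * H)"
  using div_mult_mod_eq[of "j + H" "2 * H"] by (simp add: wrap_def)

definition periodise :: "int \<Rightarrow> (int \<times> int \<Rightarrow> 'a) \<Rightarrow> (int \<times> int \<Rightarrow> 'a)" where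
  "periodise H x = (\<lambda>h. x (fst h, wrap H (snd h)))"

lemma vperiodic_periodise: "vperiodic (2 * H) (periodise H x)"
proof -
  have "wrap H (j - 2 * H) = wrap H j" for j
    using mod_add_self2[of "j - H" "2 * H"] by (simp add: wrap_def algebra_simps)
  then show ?thesis by (auto simp: vperiodic_def shift_by_def periodise_def fun_eq_iff)
qed

text \<open>Exchanging the axes carries every statement about columns to the corresponding statement about rows.\<close>

definition swap_axes :: "(int \<times> int \<Rightarrow> 'a) \<Rightarrow> (int \<times> int \<Rightarrow> 'a)" where
  "swap_axes x = (\<lambda>h. x (snd h, fst h))"

lemma swap_axes_swap_axes [simp]: "swap_axes (swap_axes x) = x"
  by (simp add: swap_axes_def)

lemma swap_axes_shift: "swap_axes (shift_by g x) = shift_by (snd g, fst g) (swap_axes x)"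
  by (cases g) (simp add: swap_axes_def shift_by_def fun_eq_iff)

lemma swap_axes_const [simp]: "swap_axes (\<lambda>_. c) = (\<lambda>_. c)"
  by (simp add: swap_axes_def)

lemma swap_axes_iter:
  fixes f :: "(int \<times> int \<Rightarrow> 'a) \<Rightarrow> (int \<times> int \<Rightarrow> 'a)"
  shows "((\<lambda>x. swap_axes (f (swap_axes x))) ^^ n) x = swap_axes ((f ^^ n) (swap_axes x))"
  by (induction n) simp_all

section \<open>Asymptotically nilpotent automata on shifts of finite type\<close>

text \<open>The combinatorial content of the hypotheses: \<open>locally_in\<close> says that \<open>X\<close> is of finite type with windows of
radius \<open>r\<close>, and \<open>map_local\<close> that \<open>f\<close> is a cellular automaton of radius \<open>r\<close>.  One radius serves both purposes.\<close>

locale sft_ca =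
  fixes X :: "(int \<times> int \<Rightarrow> 'a) set"
    and f :: "(int \<times> int \<Rightarrow> 'a) \<Rightarrow> (int \<times> int \<Rightarrow> 'a)"
    and z :: 'a
    and r :: int
  assumes r_nonneg: "0 \<le> r"
    and zero_in: "(\<lambda>_. z) \<in> X"
    and shift_in: "x \<in> X \<Longrightarrow> shift_by g x \<in> X"
    and locally_in: "(\<And>g. \<exists>y\<in>X. \<forall>h. near r g h \<longrightarrow> x h = y h) \<Longrightarrow> x \<in> X"
    and map_in: "x \<in> X \<Longrightarrow> f x \<in> X"
    and map_local: "x \<in> X \<Longrightarrow> y \<in> X \<Longrightarrow> (\<And>h. near r g h \<Longrightarrow> x h = y h) \<Longrightarrow> f x g = f y g"
    and map_shift: "x \<in> X \<Longrightarrow> f (shift_by g x) = shift_by g (f x)"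
    and map_zero: "f (\<lambda>_. z) = (\<lambda>_. z)"
    and asymptotic: "x \<in> X \<Longrightarrow> \<exists>N. \<forall>n\<ge>N. (f ^^ n) x h = z"
begin

lemma iter_in: "x \<in> X \<Longrightarrow> (f ^^ n) x \<in> X"
  by (induction n) (auto intro: map_in)

lemma iter_split: "m \<le> n \<Longrightarrow> (f ^^ n) x = (f ^^ (n - m)) ((f ^^ m) x)"
  by (metis funpow_add le_add_diff_inverse2 o_apply)

lemma iter_zero: "(f ^^ n) (\<lambda>_. z) = (\<lambda>_. z)"
  by (induction n) (auto simp: map_zero)

lemma iter_shift: "x \<in> X \<Longrightarrow> (f ^^ n) (shift_by g x) = shift_by g ((f ^^ n) x)"
  by (induction n) (auto simp: map_shift iter_in)

lemma iter_local:
  assumes "x \<in> X" "y \<in> X" "\<And>h. near (r * int n) g h \<Longrightarrow> x h = y h"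
  shows "(f ^^ n) x g = (f ^^ n) y g"
  using assms(3)
proof (induction n arbitrary: g)
  case 0
  show ?case using 0[of g] by (simp add: near_def)
next
  case (Suc n)
  have "f ((f ^^ n) x) g = f ((f ^^ n) y) g"
  proof (rule map_local)
    fix h assume h: "near r g h"
    show "(f ^^ n) x h = (f ^^ n) y h"
    proof (rule Suc.IH)
      fix i assume "near (r * int n) h i"
      then have "near (r + r * int n) g i" using h near_trans by blast
      then show "x i = y i" using Suc.prems by (simp add: algebra_simps)
    qed
  qed (use assms iter_in in auto)
  then show ?case by simp
qed

lemma iter_local_zero:
  assumes "x \<in> X" "\<And>h. near (r * int n) g h \<Longrightarrow> x h = z"
  shows "(f ^^ n) x g = z"
  using iter_local[OF assms(1) zero_in, of n g] assms(2) by (simp add: iter_zero)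

lemma asymptotic_finite:
  assumes "x \<in> X" "finite W"
  shows "\<exists>N. \<forall>n\<ge>N. \<forall>h\<in>W. (f ^^ n) x h = z"
proof -
  obtain N where N: "\<And>h n. n \<ge> N h \<Longrightarrow> (f ^^ n) x h = z"
    using asymptotic[OF assms(1)] by metis
  have "\<forall>n\<ge>Max (insert 0 (N ` W)). \<forall>h\<in>W. (f ^^ n) x h = z"
    using N assms(2) by auto
  then show ?thesis by blast
qed

definition mortal :: "(int \<times> int \<Rightarrow> 'a) \<Rightarrow> bool" where
  "mortal x \<longleftrightarrow> (\<exists>n. (f ^^ n) x = (\<lambda>_. z))"

lemma iter_zero_mono:
  assumes "(f ^^ m) x = (\<lambda>_. z)" "m \<le> n"
  shows "(f ^^ n) x = (\<lambda>_. z)"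
  using iter_split[OF assms(2)] assms(1) by (simp add: iter_zero)

section \<open>Stacking late visits\<close>

text \<open>Start from \<open>c0\<close> and apply the extension property again and again, at stage \<open>n\<close> with a time bound \<open>n\<close> and a
region so large that the light cones of the earlier visits lie inside it.  The limit point keeps all the
visits.  It belongs to \<open>X\<close> because its windows occur in the approximating points.
This plays the role of the Baire category theorem for a family \<open>P\<close> that need not be closed.\<close>

lemma no_recurrent_extension:
  assumes lip: "lipschitz \<nu>" and W: "finite W" and PX: "P \<subseteq> X" and P0: "c0 \<in> P"
    and step: "\<And>c K s. c \<in> P \<Longrightarrow>
      \<exists>x\<in>P. (\<forall>h. \<nu> h \<le> K \<longrightarrow> x h = c h) \<and> (\<exists>k\<ge>s. \<exists>h\<in>W. (f ^^ k) x h \<noteq> z)"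
  shows False
proof -
  \<comment> \<open>A stage is a pair of a point and the radius of the region on which it is frozen.\<close>
  define good where "good n p \<longleftrightarrow> fst p \<in> P \<and> int n \<le> snd p" for n :: nat and p :: "(int \<times> int \<Rightarrow> 'a) \<times> int"
  define next_ok where "next_ok n p p' \<longleftrightarrow> (\<forall>h. \<nu> h \<le> snd p \<longrightarrow> fst p' h = fst p h) \<and> snd p \<le> snd p' \<and>
      (\<exists>k\<ge>n. \<exists>h\<in>W. (f ^^ k) (fst p') h \<noteq> z \<and> \<nu> h + r * int k \<le> snd p')"
    for n :: nat and p p' :: "(int \<times> int \<Rightarrow> 'a) \<times> int"
  have "\<exists>q. \<forall>n. good n (q n) \<and> next_ok n (q n) (q (Suc n))"
  proof (rule dependent_nat_choice)
    show "\<exists>p. good 0 p" using P0 by (intro exI[of _ "(c0, 0)"]) (simp add: good_def)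
  next
    fix p n assume g: "good n p"
    obtain x k h where x: "x \<in> P" "\<forall>h. \<nu> h \<le> snd p \<longrightarrow> x h = fst p h" "k \<ge> n" "h \<in> W" "(f ^^ k) x h \<noteq> z"
      using step[of "fst p" "snd p" n] g unfolding good_def by blast
    \<comment> \<open>The new radius contains the whole light cone of the visit just obtained.\<close>
    define p' where "p' = (x, max (snd p + 1) (\<nu> h + r * int k))"
    have "good (Suc n) p'" using x g by (simp add: good_def p'_def le_max_iff_disj)
    moreover have "next_ok n p p'"
      unfolding next_ok_def
    proof (intro conjI exI[of _ k] bexI[of _ h])
      show "\<forall>h. \<nu> h \<le> snd p \<longrightarrow> fst p' h = fst p h" using x by (simp add: p'_def)
    qed (use x in \<open>simp_all add: p'_def\<close>)
    ultimately show "\<exists>p'. good (Suc n) p' \<and> next_ok n p p'" by blast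
  qed
  then obtain q where q: "\<And>n. good n (q n)" "\<And>n. next_ok n (q n) (q (Suc n))" by blast
  define c where "c n = fst (q n)" for n
  define K where "K n = snd (q n)" for n
  have cX: "c n \<in> X" for n using q(1)[of n] PX by (auto simp: good_def c_def)
  have Kn: "int n \<le> K n" for n using q(1)[of n] by (auto simp: good_def K_def)
  have K_mono: "m \<le> n \<Longrightarrow> K m \<le> K n" for m n
    using lift_Suc_mono_le[of K] q(2) by (simp add: next_ok_def K_def)
  have agree: "m \<le> n \<Longrightarrow> \<nu> h \<le> K m \<Longrightarrow> c n h = c m h" for m n h
  proof (induction n rule: dec_induct)
    case (step n)
    then have "\<nu> h \<le> K n" using K_mono[of m n] by simp
    then have "c (Suc n) h = c n h" using q(2)[of n] unfolding next_ok_def c_def K_def by blast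
    then show ?case using step by simp
  qed simp
  define y where "y h = c (nat (\<nu> h)) h" for h
  have y: "y h = c n h" if "\<nu> h \<le> K n" for h n
  proof (cases "n \<le> nat (\<nu> h)")
    case True then show ?thesis using agree that by (simp add: y_def)
  next
    case False
    have "\<nu> h \<le> K (nat (\<nu> h))" using Kn[of "nat (\<nu> h)"] by linarith
    then show ?thesis using agree[of "nat (\<nu> h)" n h] False by (simp add: y_def)
  qed
  have yX: "y \<in> X"
  proof (rule locally_in)
    fix g
    have "y h = c (nat (\<nu> g + r)) h" if "near r g h" for h
    proof (rule y)
      have "\<nu> h \<le> \<nu> g + r" using lipschitzD[OF lip that] by linarith
      then show "\<nu> h \<le> K (nat (\<nu> g + r))" using Kn[of "nat (\<nu> g + r)"] by linarith
    qed
    then show "\<exists>x\<in>X. \<forall>h. near r g h \<longrightarrow> y h = x h" using cX by blast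
  qed
  obtain N where N: "\<forall>n\<ge>N. \<forall>h\<in>W. (f ^^ n) y h = z" using asymptotic_finite[OF yX W] by blast
  obtain k h where k: "k \<ge> N" "h \<in> W" "(f ^^ k) (c (Suc N)) h \<noteq> z" "\<nu> h + r * int k \<le> K (Suc N)"
    using q(2)[of N] unfolding next_ok_def c_def K_def by blast
  have "(f ^^ k) y h = (f ^^ k) (c (Suc N)) h"
  proof (rule iter_local[OF yX cX])
    fix i assume "near (r * int k) h i"
    then have "\<nu> i \<le> \<nu> h + r * int k" using lipschitzD[OF lip] by fastforce
    then show "y i = c (Suc N) i" using y k by simp
  qed
  then show False using N k by simp
qed

text \<open>Apply the previous lemma to the family of mortal bounded points.  A bounded point \<open>c\<close> that dies at time \<open>M\<close> is
superposed with a point \<open>e\<close> of \<open>spread\<close> that starts outside a much larger region.  At time \<open>M\<close> only \<open>e\<close> is left,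
and it has not yet interacted with \<open>c\<close>.  So the sum is again mortal and inherits the visit of \<open>e\<close>, which
is late because \<open>e\<close> comes from far away.\<close>

lemma no_mortal_spreading:
  assumes lip: "lipschitz \<nu>" and W: "finite W"
    and spread: "\<And>S. \<exists>e\<in>X. mortal e \<and> (\<exists>a. \<forall>h. \<nu> h > a \<longrightarrow> e h = z) \<and> (\<forall>h. \<nu> h \<le> S \<longrightarrow> e h = z)
        \<and> (\<exists>t. \<exists>h\<in>W. (f ^^ t) e h \<noteq> z)"
  shows False
proof -
  define P where "P = {x \<in> X. mortal x \<and> (\<exists>a. \<forall>h. \<nu> h > a \<longrightarrow> x h = z)}"
  have zP: "(\<lambda>_. z) \<in> P" unfolding P_def mortal_def using zero_in iter_zero by auto
  have PX: "P \<subseteq> X" unfolding P_def by blast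
  obtain w where w: "\<And>h. h \<in> W \<Longrightarrow> \<bar>\<nu> h\<bar> \<le> w"
    using W by (metis (no_types, lifting) finite_imageI imageI Max_ge)
  show False
  proof (rule no_recurrent_extension[OF lip W PX zP])
    fix c K s assume "c \<in> P"
    then obtain M a where c: "c \<in> X" "(f ^^ M) c = (\<lambda>_. z)" "\<And>h. \<nu> h > a \<Longrightarrow> c h = z"
      unfolding P_def mortal_def by blast
    \<comment> \<open>The summands ask for agreement with \<open>c\<close>, for separation up to time \<open>M\<close>, and for a late visit.\<close>
    define S where "S = max K (max (a + 2 * r + 2 * (r * int M) + 1) (w + r * int (M + s)))"
    have S: "K \<le> S" "a + 2 * r + 2 * (r * int M) + 1 \<le> S" "w + r * int (M + s) \<le> S"
      unfolding S_def by linarith+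
    obtain e b t h where e: "e \<in> X" "mortal e" "\<And>h. \<nu> h > b \<Longrightarrow> e h = z" "\<And>h. \<nu> h \<le> S \<Longrightarrow> e h = z"
       "h \<in> W" "(f ^^ t) e h \<noteq> z" using spread[of S] by blast
    define x where "x h = (if \<nu> h \<le> S then c h else e h)" for h
    have nr: "\<bar>\<nu> h - \<nu> g\<bar> \<le> k" if "near k g h" for k g h
      using lipschitzD[OF lip that] .
    have rM: "0 \<le> r * int M" using r_nonneg by simp
    have xc: "x h = c h" if "\<nu> h \<le> S" for h using that by (simp add: x_def)
    have xe: "x h = e h" if "\<nu> h > a" for h using that c(3) e(4) by (simp add: x_def)
    have xX: "x \<in> X"
    proof (rule locally_in)
      fix g
      show "\<exists>y\<in>X. \<forall>h. near r g h \<longrightarrow> x h = y h"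
      proof (cases "\<nu> g \<le> a + r")
        case True
        have "x h = c h" if "near r g h" for h
          using nr[OF that] rM S(2) True r_nonneg by (intro xc) linarith
        then show ?thesis using c by blast
      next
        case False
        have "x h = e h" if "near r g h" for h
          using nr[OF that] False by (intro xe) linarith
        then show ?thesis using e by blast
      qed
    qed
    \<comment> \<open>Within reach of \<open>c\<close> both sides are zero at time \<open>M\<close>; further out \<open>x\<close> and \<open>e\<close> coincide initially.\<close>
    have xM: "(f ^^ M) x = (f ^^ M) e"
    proof
      fix g
      show "(f ^^ M) x g = (f ^^ M) e g"
      proof (cases "\<nu> g \<le> a + r * int M")
        case True
        have *: "\<nu> h \<le> S" if "near (r * int M) g h" for h
          using nr[OF that] True r_nonneg S(2) by linarith
        have "(f ^^ M) x g = (f ^^ M) c g" by (rule iter_local[OF xX c(1)]) (use xc * in blast)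
        moreover have "(f ^^ M) e g = z" by (rule iter_local_zero[OF e(1)]) (use e(4) * in blast)
        ultimately show ?thesis using c(2) by simp
      next
        case False
        have "x h = e h" if "near (r * int M) g h" for h
          using nr[OF that] False by (intro xe) linarith
        then show ?thesis by (intro iter_local[OF xX e(1)])
      qed
    qed
    have xlate: "(f ^^ n) x = (f ^^ n) e" if "n \<ge> M" for n
      using xM iter_split[OF that] by simp
    have t: "t \<ge> M + s"
    proof (rule ccontr)
      assume "\<not> ?thesis"
      then have "r * int t \<le> r * int (M + s)" using r_nonneg by (intro mult_left_mono) auto
      then have "\<nu> g \<le> S" if "near (r * int t) h g" for g
        using nr[OF that] w[OF e(5)] S(3) by linarith
      then have "(f ^^ t) e h = z" by (intro iter_local_zero[OF e(1)] e(4))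
      then show False using e by simp
    qed
    have "mortal x"
    proof -
      obtain n where "(f ^^ n) e = (\<lambda>_. z)" using e(2) mortal_def by blast
      then have "(f ^^ (max n M)) x = (\<lambda>_. z)" using xlate iter_zero_mono[of n e "max n M"] by simp
      then show ?thesis unfolding mortal_def by blast
    qed
    moreover have "\<forall>h. \<nu> h > max a b \<longrightarrow> x h = z" using xe e(3) by simp
    ultimately have "x \<in> P" unfolding P_def using xX by blast
    moreover have "\<forall>h. \<nu> h \<le> K \<longrightarrow> x h = c h" using xc S(1) by simp
    moreover have "(f ^^ t) x h \<noteq> z" using xlate e t by simp
    ultimately show "\<exists>x\<in>P. (\<forall>h. \<nu> h \<le> K \<longrightarrow> x h = c h) \<and> (\<exists>k\<ge>s. \<exists>h\<in>W. (f ^^ k) x h \<noteq> z)"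
      using t e(5) by (meson add_leD2)
  qed
qed

section \<open>Vertically periodic points on finitely many columns are mortal\<close>

lemma vperiodic_iter: "x \<in> X \<Longrightarrow> vperiodic q x \<Longrightarrow> vperiodic q ((f ^^ n) x)"
  unfolding vperiodic_def by (metis iter_shift)

text \<open>Modulo the period only finitely many cells remain, so pointwise convergence to zero is uniform.\<close>

lemma confined_mortal:
  assumes "x \<in> X" "0 < q" "vperiodic q x" "\<And>n h. \<bar>fst h\<bar> > a \<Longrightarrow> (f ^^ n) x h = z"
  shows "mortal x"
proof -
  obtain N where N: "\<forall>n\<ge>N. \<forall>h\<in>{-a..a} \<times> {0..<q}. (f ^^ n) x h = z"
    using asymptotic_finite[OF assms(1), of "{-a..a} \<times> {0..<q}"] by blast
  have "(f ^^ N) x (i, j) = z" for i j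
  proof (cases "\<bar>i\<bar> > a")
    case False
    then have "(i, j mod q) \<in> {-a..a} \<times> {0..<q}" using assms(2) by auto
    then have "(f ^^ N) x (i, j mod q) = z" using N by blast
    then show ?thesis using vperiodic_mod[OF vperiodic_iter[OF assms(1,3)]] by metis
  qed (use assms(4) in auto)
  then show ?thesis unfolding mortal_def by (auto simp: fun_eq_iff)
qed

text \<open>The columns \<open>A, \<dots>, A + 2 * r\<close> and \<open>B, \<dots>, B + 2 * r\<close> are the two seams.  A seam of width \<open>2 * r + 1\<close> is
wider than the reach of a window from either side, so what happens between the seams ignores the outside.\<close>

definition cut :: "int \<Rightarrow> int \<Rightarrow> (int \<times> int \<Rightarrow> 'a) \<Rightarrow> (int \<times> int \<Rightarrow> 'a)" where
  "cut A B x = (\<lambda>h. if A \<le> fst h \<and> fst h \<le> B + 2 * r then x h else z)"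

lemma cut_near:
  assumes "\<And>h. A \<le> fst h \<Longrightarrow> fst h \<le> A + 2 * r \<Longrightarrow> x h = z"
    and "\<And>h. B \<le> fst h \<Longrightarrow> fst h \<le> B + 2 * r \<Longrightarrow> x h = z"
  shows "(\<forall>h. near r g h \<longrightarrow> cut A B x h = (if A + r \<le> fst g \<and> fst g \<le> B + r then x h else z))"
  using assms by (auto simp: cut_def near_def)

lemma cut_in:
  assumes "x \<in> X"
    and "\<And>h. A \<le> fst h \<Longrightarrow> fst h \<le> A + 2 * r \<Longrightarrow> x h = z"
    and "\<And>h. B \<le> fst h \<Longrightarrow> fst h \<le> B + 2 * r \<Longrightarrow> x h = z"
  shows "cut A B x \<in> X"
proof (rule locally_in)
  fix g
  show "\<exists>y\<in>X. \<forall>h. near r g h \<longrightarrow> cut A B x h = y h"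
    using cut_near[of A x B g] assms zero_in by (cases "A + r \<le> fst g \<and> fst g \<le> B + r") auto
qed

lemma map_cut:
  assumes x: "x \<in> X"
    and A: "\<And>h. A \<le> fst h \<Longrightarrow> fst h \<le> A + 2 * r \<Longrightarrow> x h = z \<and> f x h = z"
    and B: "\<And>h. B \<le> fst h \<Longrightarrow> fst h \<le> B + 2 * r \<Longrightarrow> x h = z \<and> f x h = z"
  shows "f (cut A B x) = cut A B (f x)"
proof
  fix g
  have cX: "cut A B x \<in> X" using cut_in x A B by blast
  have near: "\<forall>h. near r g h \<longrightarrow> cut A B x h = (if A + r \<le> fst g \<and> fst g \<le> B + r then x h else z)"
    using cut_near[of A x B g] A B by blast
  show "f (cut A B x) g = cut A B (f x) g"
  proof (cases "A + r \<le> fst g \<and> fst g \<le> B + r")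
    case True
    then have "f (cut A B x) g = f x g" using near by (intro map_local[OF cX x]) auto
    then show ?thesis using True r_nonneg by (simp add: cut_def)
  next
    case False
    then have "f (cut A B x) g = f (\<lambda>_. z) g" using near by (intro map_local[OF cX zero_in]) auto
    then show ?thesis using False A[of g] B[of g] r_nonneg by (auto simp: cut_def map_zero)
  qed
qed

lemma iter_cut:
  assumes x: "x \<in> X"
    and "\<And>n h. A \<le> fst h \<Longrightarrow> fst h \<le> A + 2 * r \<Longrightarrow> (f ^^ n) x h = z"
    and "\<And>n h. B \<le> fst h \<Longrightarrow> fst h \<le> B + 2 * r \<Longrightarrow> (f ^^ n) x h = z"
  shows "(f ^^ n) (cut A B x) = cut A B ((f ^^ n) x)"
proof (induction n)
  case (Suc n)
  have "f (cut A B ((f ^^ n) x)) = cut A B (f ((f ^^ n) x))"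
    using assms(2)[of _ n] assms(2)[of _ "Suc n"] assms(3)[of _ n] assms(3)[of _ "Suc n"]
    by (intro map_cut iter_in x) auto
  then show ?case using Suc by simp
qed simp

text \<open>If \<open>u\<close> is not mortal, every bound on the columns that its orbit visits is exceeded.  The family \<open>P\<close> of points of
the same kind cannot have the extension property of \<open>no_recurrent_extension\<close>, and its failure is a wall: a pattern \<open>c\<close>
on finitely many columns after which the columns \<open>0, \<dots>, 2 * r\<close> are zero from time \<open>s\<close> on, whatever member of
\<open>P\<close> contains it.  Between two distant copies of the wall put a translate \<open>y\<close> of \<open>u\<close> that reaches column zero from far away, run \<open>s\<close> steps,
and cut at the walls.  The piece \<open>e\<close> is a point of \<open>X\<close> in its own right; it is confined between the seams, hence
mortal.  The wall time \<open>s\<close> is fixed before the distance, so \<open>e\<close> still starts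
far from column zero and the visit is still to come.  This contradicts \<open>no_mortal_spreading\<close>.\<close>

theorem vperiodic_mortal:
  assumes u: "u \<in> X" "0 < q" "vperiodic q u" "\<And>h. \<bar>fst h\<bar> > a \<Longrightarrow> u h = z"
  shows "mortal u"
proof (rule ccontr)
  assume immortal: "\<not> mortal u"
  define P where "P = {x \<in> X. vperiodic q x \<and> (\<exists>a. \<forall>h. \<bar>fst h\<bar> > a \<longrightarrow> x h = z)}"
  define W where "W = {0..2 * r} \<times> {0..<q}"
  have PX: "P \<subseteq> X" and W: "finite W" by (auto simp: P_def W_def)
  have uP: "u \<in> P" using u unfolding P_def by blast
  have shiftP: "shift_by (d, 0) x \<in> P" if x: "x \<in> P" for d x
  proof -
    obtain b where b: "\<And>h. \<bar>fst h\<bar> > b \<Longrightarrow> x h = z" using x P_def by blast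
    have "\<forall>h. \<bar>fst h\<bar> > b + \<bar>d\<bar> \<longrightarrow> shift_by (d, 0) x h = z"
      by (auto simp: shift_by_def intro!: b)
    then show ?thesis using x shift_in vperiodic_shift unfolding P_def by blast
  qed
  obtain c K s where c: "c \<in> P" and
    wall: "\<And>x k h. x \<in> P \<Longrightarrow> (\<And>h. \<bar>fst h\<bar> \<le> K \<Longrightarrow> x h = c h) \<Longrightarrow> k \<ge> s \<Longrightarrow> h \<in> W \<Longrightarrow> (f ^^ k) x h = z"
    using no_recurrent_extension[OF lipschitz_fst W PX uP] by blast
  obtain a0 where a0: "\<And>h. \<bar>fst h\<bar> > a0 \<Longrightarrow> c h = z" using c P_def by blast
  have cX: "c \<in> X" using c PX by blast
  define b where "b = max 0 (max a0 K)"
  have b: "0 \<le> b" "a0 \<le> b" "K \<le> b" by (auto simp: b_def)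
  show False
  proof (rule no_mortal_spreading[OF lipschitz_fst, of "{0} \<times> {0..<q}"])
    fix S0 :: int
    define S where "S = max 0 S0"
    \<comment> \<open>Room for the \<open>s\<close> steps that pass before the cut.\<close>
    define S1 where "S1 = S + r * int s"
    have S1: "0 \<le> S" "S \<le> S1" "S0 \<le> S" using r_nonneg by (auto simp: S1_def S_def)
    obtain t i j where t: "\<bar>i\<bar> > S1 + \<bar>a\<bar>" "(f ^^ t) u (i, j) \<noteq> z"
      using confined_mortal[OF u(1-3), of "S1 + \<bar>a\<bar>"] immortal by fastforce
    define y where "y = shift_by (-i, 0) u"
    have yP: "y \<in> P" and yX: "y \<in> X" using shiftP[OF uP] PX by (auto simp: y_def)
    define a1 where "a1 = \<bar>a\<bar> + \<bar>i\<bar>"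
    have y_out: "y h = z" if "\<bar>fst h\<bar> > a1" for h
      unfolding y_def shift_by_def using that by (intro u(4)) (auto simp: a1_def)
    have y_in: "y h = z" if "\<bar>fst h\<bar> \<le> S1" for h
      unfolding y_def shift_by_def using that t by (intro u(4)) auto
    have "shift_by (-i, 0) ((f ^^ t) u) (0, j) \<noteq> z" using t by (simp add: shift_by_def)
    then have "(f ^^ t) y (0, j) \<noteq> z" using u(1) by (simp add: y_def iter_shift)
    then have y_visit: "(f ^^ t) y (0, j mod q) \<noteq> z"
      using vperiodic_mod[OF vperiodic_iter[OF yX]] yP unfolding P_def by (metis (mono_tags) mem_Collect_eq)
    \<comment> \<open>The visit happens only after the walls have become zero.\<close>
    have "\<not> r * int t \<le> S1"
    proof
      assume *: "r * int t \<le> S1"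
      have "(f ^^ t) y (0, j mod q) = z"
        by (rule iter_local_zero[OF yX], rule y_in) (use * in \<open>auto simp: near_def\<close>)
      then show False using y_visit by simp
    qed
    then have "r * int s < r * int t" using S1(1) by (simp add: S1_def)
    then have st: "s \<le> t" using r_nonneg by (simp add: mult_less_cancel_left)
    \<comment> \<open>The walls are so distant that they overlap neither \<open>y\<close> nor the light cone of its visit.\<close>
    define D where "D = a1 + b + 2 * r + r * int t + S1 + 1"
    have rt: "0 \<le> r * int t" "0 \<le> r * int s" using r_nonneg by simp_all
    have a1: "0 \<le> a1" by (simp add: a1_def)
    have D: "a1 + b < D" "a1 + 2 * r < D - b" "S1 < D - b" "r * int t < D - b" "0 \<le> D"
      unfolding D_def using rt S1 r_nonneg a1 b by linarith+
    \<comment> \<open>A copy of the wall pattern on either side of \<open>y\<close>.\<close>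
    define x where "x h = (if fst h \<ge> D - b then c (fst h - D, snd h)
       else if fst h \<le> -(D - b) then c (fst h + D, snd h) else y h)" for h
    have x_mid: "x h = y h" if "\<bar>fst h\<bar> < D - b" for h using that by (auto simp: x_def)
    have x_right: "x h = shift_by (D, 0) c h" if "fst h > a1" for h
    proof -
      have "shift_by (D, 0) c h = c (fst h - D, snd h)" by (cases h) (simp add: shift_by_def)
      moreover have "c (fst h - D, snd h) = z" if "fst h < D - b" using that b by (intro a0) simp
      ultimately show ?thesis using that y_out[of h] D(1) a1 by (auto simp: x_def)
    qed
    have x_left: "x h = shift_by (-D, 0) c h" if "fst h < - a1" for h
    proof -
      have "shift_by (-D, 0) c h = c (fst h + D, snd h)" by (cases h) (simp add: shift_by_def)
      moreover have "c (fst h + D, snd h) = z" if "fst h > -(D - b)" using that b by (intro a0) simp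
      ultimately show ?thesis using that y_out[of h] D(1) a1 by (auto simp: x_def)
    qed
    have xX: "x \<in> X"
    proof (rule locally_in)
      fix g :: "int \<times> int"
      consider "\<bar>fst g\<bar> \<le> a1 + r" | "fst g > a1 + r" | "fst g < - (a1 + r)" by linarith
      then show "\<exists>y\<in>X. \<forall>h. near r g h \<longrightarrow> x h = y h"
      proof cases
        case 1
        then have "\<forall>h. near r g h \<longrightarrow> x h = y h"
          using D by (intro allI impI x_mid) (auto simp: near_def)
        then show ?thesis using yX by blast
      next
        case 2
        then have "\<forall>h. near r g h \<longrightarrow> x h = shift_by (D, 0) c h"
          by (intro allI impI x_right) (auto simp: near_def)
        then show ?thesis using shift_in cX by blast
      next
        case 3
        then have "\<forall>h. near r g h \<longrightarrow> x h = shift_by (-D, 0) c h"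
          by (intro allI impI x_left) (auto simp: near_def)
        then show ?thesis using shift_in cX by blast
      qed
    qed
    have xper: "vperiodic q x"
    proof -
      have "c (k, l - q) = c (k, l)" "y (k, l - q) = y (k, l)" for k l
        using vperiodicD[of q c k "l - q" 1] vperiodicD[of q y k "l - q" 1] c yP by (simp_all add: P_def)
      then show ?thesis by (auto simp: vperiodic_def shift_by_def x_def fun_eq_iff)
    qed
    have x_out: "x h = z" if "\<bar>fst h\<bar> > D + b" for h
      using that b D a0[of "(fst h - D, snd h)"] a0[of "(fst h + D, snd h)"]
      by (auto simp: x_def)
    have xP: "x \<in> P" using xX xper x_out unfolding P_def by blast
    have xwall: "(f ^^ k) x h = z"
      if k: "k \<ge> s" and h: "d \<le> fst h" "fst h \<le> d + 2 * r" and d: "d = D \<or> d = - D" for k h d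
    proof -
      obtain i j where h': "h = (i, j)" by fastforce
      have "(f ^^ k) (shift_by (-d, 0) x) (i - d, j mod q) = z"
      proof (rule wall[OF shiftP[OF xP] _ k])
        fix g :: "int \<times> int" assume g: "\<bar>fst g\<bar> \<le> K"
        obtain l m where lm: "g = (l, m)" by fastforce
        show "shift_by (-d, 0) x g = c g"
          using x_right[of "(l + D, m)"] x_left[of "(l - D, m)"] d lm g b D(1) by (auto simp: shift_by_def)
      qed (use h h' u(2) in \<open>auto simp: W_def\<close>)
      then have "shift_by (-d, 0) ((f ^^ k) x) (i - d, j mod q) = z" using iter_shift[OF xX] by metis
      then have "(f ^^ k) x (i, j mod q) = z" by (simp add: shift_by_def)
      then show ?thesis using vperiodic_mod[OF vperiodic_iter[OF xX xper]] h' by metis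
    qed
    define e where "e = cut (-D) D ((f ^^ s) x)"
    have xs: "(f ^^ n) ((f ^^ s) x) = (f ^^ (n + s)) x" for n by (simp add: funpow_add)
    have eX: "e \<in> X" unfolding e_def
      by (rule cut_in) (use xwall iter_in[OF xX] in auto)
    have e_iter: "(f ^^ n) e = cut (-D) D ((f ^^ (n + s)) x)" for n
      unfolding e_def xs[symmetric]
      by (rule iter_cut) (use xwall iter_in[OF xX] in \<open>auto simp: xs\<close>)
    have e_per: "vperiodic q e"
      using vperiodic_iter[OF xX xper, of s]
      by (auto simp: e_def vperiodic_def cut_def shift_by_def fun_eq_iff)
    have e_conf: "(f ^^ n) e h = z" if "\<bar>fst h\<bar> > D + 2 * r" for n h
      using that r_nonneg by (auto simp: e_iter cut_def)
    have "mortal e" by (rule confined_mortal[OF eX u(2) e_per e_conf])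
    moreover have "\<forall>h. \<bar>fst h\<bar> > D + 2 * r \<longrightarrow> e h = z" using e_conf[of _ 0] by simp
    moreover have "\<forall>h. \<bar>fst h\<bar> \<le> S0 \<longrightarrow> e h = z"
    proof (intro allI impI)
      fix h :: "int \<times> int" assume h: "\<bar>fst h\<bar> \<le> S0"
      have "(f ^^ s) x h = z"
      proof (rule iter_local_zero[OF xX])
        fix g assume "near (r * int s) h g"
        then have "\<bar>fst g\<bar> \<le> S1" using h S1 by (auto simp: near_def S1_def)
        then show "x g = z" using x_mid[of g] y_in[of g] D by simp
      qed
      then show "e h = z" by (simp add: e_def cut_def)
    qed
    moreover have "(f ^^ (t - s)) e (0, j mod q) \<noteq> z"
    proof -
      have "(f ^^ t) x (0, j mod q) = (f ^^ t) y (0, j mod q)"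
        by (rule iter_local[OF xX yX], rule x_mid)
          (use D in \<open>auto simp: near_def\<close>)
      then show ?thesis using y_visit st r_nonneg D by (simp add: e_iter cut_def)
    qed
    moreover have "(0, j mod q) \<in> {0} \<times> {0..<q}" using u(2) by simp
    ultimately show "\<exists>e\<in>X. mortal e \<and> (\<exists>a. \<forall>h. \<bar>fst h\<bar> > a \<longrightarrow> e h = z) \<and>
        (\<forall>h. \<bar>fst h\<bar> \<le> S0 \<longrightarrow> e h = z) \<and> (\<exists>t. \<exists>h\<in>{0} \<times> {0..<q}. (f ^^ t) e h \<noteq> z)"
      using eX by blast
  qed simp
qed

lemma mortal_shift:
  assumes "x \<in> X" "mortal x"
  shows "mortal (shift_by g x)"
proof -
  obtain n where "(f ^^ n) x = (\<lambda>_. z)" using assms(2) mortal_def by blast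
  then have "(f ^^ n) (shift_by g x) = shift_by g (\<lambda>_. z)" using iter_shift[OF assms(1)] by simp
  then show ?thesis unfolding mortal_def by (auto simp: shift_by_def)
qed

section \<open>Points of finite support are mortal\<close>

text \<open>Near the boundary between two periods the periodised point is zero, since \<open>e\<close> lives in the rows between \<open>- a\<close> and \<open>a\<close>;
elsewhere it is locally a translate of \<open>e\<close>.\<close>

lemma periodise_in:
  assumes e: "e \<in> X" "\<And>h. \<bar>snd h\<bar> > a \<Longrightarrow> e h = z" and H: "H > \<bar>a\<bar> + 2 * r"
  shows "periodise H e \<in> X"
proof (rule locally_in)
  fix g :: "int \<times> int"
  have H0: "0 < H" using H r_nonneg by linarith
  define c where "c = (snd g + H) div (2 * H)"
  define w where "w = wrap H (snd g)"
  have w: "snd g = w + c * (2 * H)" "- H \<le> w" "w < H"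
    unfolding w_def c_def by (rule wrap_decomp) (simp_all add: wrap_bounds[OF H0])
  show "\<exists>y\<in>X. \<forall>h. near r g h \<longrightarrow> periodise H e h = y h"
  proof (cases "- H + r \<le> w \<and> w < H - r")
    case True
    have "periodise H e h = shift_by (0, c * (2 * H)) e h" if "near r g h" for h
    proof -
      have "wrap H (snd h) = snd h - c * (2 * H)"
        by (rule wrap_eqI[where c = c]) (use True that w in \<open>auto simp: near_def\<close>)
      then show ?thesis by (cases h) (simp add: periodise_def shift_by_def)
    qed
    then show ?thesis using shift_in[OF e(1)] by blast
  next
    case False
    have "periodise H e h = z" if "near r g h" for h
    proof -
      define m where "m = snd h - c * (2 * H)"
      have m: "snd h = m + c * (2 * H)" "\<bar>m - w\<bar> \<le> r" using that w by (auto simp: m_def near_def)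
      consider "- H \<le> m" "m < H" | "m < - H" | "H \<le> m" by linarith
      then have "\<bar>wrap H (snd h)\<bar> > a"
      proof cases
        case 1
        then have "wrap H (snd h) = m" by (rule wrap_eqI[OF m(1)])
        then show ?thesis using False m(2) H w(2,3) by linarith
      next
        case 2
        have "wrap H (snd h) = m + 2 * H"
        proof (rule wrap_eqI)
          show "snd h = m + 2 * H + (c - 1) * (2 * H)" using m(1) by (simp add: algebra_simps)
        qed (use 2 m(2) w(2,3) H r_nonneg in linarith)+
        then show ?thesis using False m(2) H w(2,3) 2 r_nonneg by linarith
      next
        case 3
        have "wrap H (snd h) = m - 2 * H"
        proof (rule wrap_eqI)
          show "snd h = m - 2 * H + (c + 1) * (2 * H)" using m(1) by (simp add: algebra_simps)
        qed (use 3 m(2) w(2,3) H r_nonneg in linarith)+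
        then show ?thesis using False m(2) H w(2,3) 3 r_nonneg by linarith
      qed
      then show ?thesis using e(2) by (simp add: periodise_def)
    qed
    then show ?thesis by (intro bexI[OF _ zero_in]) blast
  qed
qed

text \<open>Suppose that the orbit of \<open>e\<close> reaches arbitrarily distant columns.  With a period larger than the light cone of a
visit, periodising \<open>e\<close> vertically does not affect that visit, and the result is mortal by \<open>vperiodic_mortal\<close>.  Translated so that the
visit happens at the origin, these points contradict \<open>no_mortal_spreading\<close>.\<close>

lemma finite_support_column_bounded:
  assumes e: "e \<in> X" "\<And>h. \<bar>fst h\<bar> > a \<Longrightarrow> e h = z" "\<And>h. \<bar>snd h\<bar> > a \<Longrightarrow> e h = z"
  shows "\<exists>A. \<forall>n h. \<bar>fst h\<bar> > A \<longrightarrow> (f ^^ n) e h = z"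
proof (rule ccontr)
  assume unbounded: "\<not> ?thesis"
  show False
  proof (rule no_mortal_spreading[OF lipschitz_fst, of "{(0, 0)}"])
    fix S :: int
    obtain t h where "\<bar>fst h\<bar> > S + \<bar>a\<bar>" "(f ^^ t) e h \<noteq> z" using unbounded by blast
    then obtain i j where t: "\<bar>i\<bar> > S + \<bar>a\<bar>" "(f ^^ t) e (i, j) \<noteq> z" by (cases h) simp
    define H where "H = \<bar>a\<bar> + \<bar>j\<bar> + r * int t + 2 * r + 1"
    have H: "H > \<bar>a\<bar> + 2 * r" "H > \<bar>j\<bar> + r * int t" "H > 0"
      using r_nonneg mult_nonneg_nonneg[OF r_nonneg, of "int t"] unfolding H_def by linarith+
    define p where "p = periodise H e"
    have pX: "p \<in> X" unfolding p_def by (rule periodise_in[OF e(1,3) H(1)])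
    have p_out: "p h = z" if "\<bar>fst h\<bar> > a" for h using that e(2) by (simp add: p_def periodise_def)
    have "mortal p"
      by (rule vperiodic_mortal[OF pX, of "2 * H" a]) (use H p_out vperiodic_periodise p_def in auto)
    define u where "u = shift_by (-i, -j) p"
    have "u \<in> X" "mortal u" using pX \<open>mortal p\<close> mortal_shift shift_in by (auto simp: u_def)
    moreover have "(f ^^ t) u (0, 0) \<noteq> z"
    proof -
      have "(f ^^ t) p (i, j) = (f ^^ t) e (i, j)"
      proof (rule iter_local[OF pX e(1)])
        fix h assume "near (r * int t) (i, j) h"
        then have "\<bar>snd h\<bar> < H" using H by (auto simp: near_def)
        then have "wrap H (snd h) = snd h" by (intro wrap_eqI[where c = 0]) auto
        then show "p h = e h" by (simp add: p_def periodise_def)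
      qed
      then have "shift_by (-i, -j) ((f ^^ t) p) (0, 0) \<noteq> z" using t by (simp add: shift_by_def)
      then show ?thesis by (simp add: u_def iter_shift[OF pX])
    qed
    moreover have "\<forall>h. \<bar>fst h\<bar> > \<bar>a\<bar> + \<bar>i\<bar> \<longrightarrow> u h = z"
      by (auto simp: u_def shift_by_def intro!: p_out)
    moreover have "\<forall>h. \<bar>fst h\<bar> \<le> S \<longrightarrow> u h = z"
      using t by (auto simp: u_def shift_by_def intro!: p_out)
    ultimately show "\<exists>e\<in>X. mortal e \<and> (\<exists>a. \<forall>h. \<bar>fst h\<bar> > a \<longrightarrow> e h = z) \<and>
        (\<forall>h. \<bar>fst h\<bar> \<le> S \<longrightarrow> e h = z) \<and> (\<exists>t. \<exists>h\<in>{(0, 0)}. (f ^^ t) e h \<noteq> z)"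
      by blast
  qed simp
qed

lemma sft_ca_swap_axes: "sft_ca {x. swap_axes x \<in> X} (\<lambda>x. swap_axes (f (swap_axes x))) z r"
proof (rule sft_ca.intro)
  fix x assume loc: "\<And>g. \<exists>y\<in>{x. swap_axes x \<in> X}. \<forall>h. near r g h \<longrightarrow> x h = y h"
  have "swap_axes x \<in> X"
  proof (rule locally_in)
    fix g :: "int \<times> int"
    obtain y where "swap_axes y \<in> X" "\<forall>h. near r (snd g, fst g) h \<longrightarrow> x h = y h"
      using loc[of "(snd g, fst g)"] by auto
    then show "\<exists>y\<in>X. \<forall>h. near r g h \<longrightarrow> swap_axes x h = y h"
      by (intro bexI[of _ "swap_axes y"]) (auto simp: swap_axes_def near_def)
  qed
  then show "x \<in> {x. swap_axes x \<in> X}" by simp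
next
  fix x y g
  assume "x \<in> {x. swap_axes x \<in> X}" "y \<in> {x. swap_axes x \<in> X}" and eq: "\<And>h. near r g h \<Longrightarrow> x h = y h"
  then have "f (swap_axes x) (snd g, fst g) = f (swap_axes y) (snd g, fst g)"
    by (intro map_local) (auto simp: swap_axes_def near_def)
  then show "swap_axes (f (swap_axes x)) g = swap_axes (f (swap_axes y)) g"
    by (simp add: swap_axes_def)
next
  fix x h
  assume "x \<in> {x. swap_axes x \<in> X}"
  then obtain N where "\<forall>n\<ge>N. (f ^^ n) (swap_axes x) (snd h, fst h) = z" using asymptotic by blast
  then show "\<exists>N. \<forall>n\<ge>N. ((\<lambda>x. swap_axes (f (swap_axes x))) ^^ n) x h = z"
    unfolding swap_axes_iter by (auto simp: swap_axes_def)
qed (use r_nonneg zero_in shift_in map_in in \<open>auto simp: swap_axes_shift map_shift map_zero\<close>)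

lemma finite_support_row_bounded:
  assumes e: "e \<in> X" "\<And>h. \<bar>fst h\<bar> > a \<Longrightarrow> e h = z" "\<And>h. \<bar>snd h\<bar> > a \<Longrightarrow> e h = z"
  shows "\<exists>A. \<forall>n h. \<bar>snd h\<bar> > A \<longrightarrow> (f ^^ n) e h = z"
proof -
  interpret T: sft_ca "{x. swap_axes x \<in> X}" "\<lambda>x. swap_axes (f (swap_axes x))" z r
    by (rule sft_ca_swap_axes)
  have "\<exists>A. \<forall>n h. \<bar>fst h\<bar> > A \<longrightarrow> ((\<lambda>x. swap_axes (f (swap_axes x))) ^^ n) (swap_axes e) h = z"
    by (rule T.finite_support_column_bounded[where a = a]) (use e in \<open>auto simp: swap_axes_def\<close>)
  then obtain A where A: "\<And>n h. \<bar>fst h\<bar> > A \<Longrightarrow> swap_axes ((f ^^ n) e) h = z"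
    unfolding swap_axes_iter swap_axes_swap_axes by blast
  have "(f ^^ n) e h = z" if "\<bar>snd h\<bar> > A" for n h
    using A[of "(snd h, fst h)" n] that by (simp add: swap_axes_def)
  then show ?thesis by blast
qed

text \<open>The orbit stays in a bounded rectangle, on which pointwise convergence to zero is uniform.\<close>

theorem finite_support_mortal:
  assumes e: "e \<in> X" "\<And>h. \<bar>fst h\<bar> > a \<Longrightarrow> e h = z" "\<And>h. \<bar>snd h\<bar> > a \<Longrightarrow> e h = z"
  shows "mortal e"
proof -
  obtain A B where A: "\<And>n h. \<bar>fst h\<bar> > A \<Longrightarrow> (f ^^ n) e h = z"
    and B: "\<And>n h. \<bar>snd h\<bar> > B \<Longrightarrow> (f ^^ n) e h = z"
    using finite_support_column_bounded[OF e] finite_support_row_bounded[OF e] by blast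
  obtain N where N: "\<forall>n\<ge>N. \<forall>h\<in>{-A..A} \<times> {-B..B}. (f ^^ n) e h = z"
    using asymptotic_finite[OF e(1), of "{-A..A} \<times> {-B..B}"] by blast
  have "(f ^^ N) e h = z" for h
    using N A[of h N] B[of h N] by (cases h) (force simp: abs_le_iff)
  then show ?thesis unfolding mortal_def by blast
qed

lemma hperiodic_mortal:
  assumes u: "u \<in> X" "0 < q" "shift_by (q, 0) u = u" "\<And>h. \<bar>snd h\<bar> > a \<Longrightarrow> u h = z"
  shows "mortal u"
proof -
  interpret T: sft_ca "{x. swap_axes x \<in> X}" "\<lambda>x. swap_axes (f (swap_axes x))" z r
    by (rule sft_ca_swap_axes)
  have "T.mortal (swap_axes u)"
  proof (rule T.vperiodic_mortal)
    show "vperiodic q (swap_axes u)"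
      unfolding vperiodic_def using u(3) by (metis fst_conv snd_conv swap_axes_shift)
  qed (use u in \<open>auto simp: swap_axes_def\<close>)
  then show ?thesis
    unfolding T.mortal_def mortal_def swap_axes_iter by (metis swap_axes_swap_axes swap_axes_const)
qed

end

section \<open>Eventually periodic extensions of sequences\<close>

lemma iterate_period:
  fixes \<beta> :: "int \<Rightarrow> 'b"
  assumes "\<And>i. i \<ge> b \<Longrightarrow> \<beta> (i + q) = \<beta> i" "0 \<le> q" "b \<le> i"
  shows "\<beta> (i + int c * q) = \<beta> i"
proof (induction c)
  case (Suc c)
  have "b \<le> i + int c * q" using assms(2,3) by (simp add: add_increasing2)
  then have "\<beta> (i + int c * q + q) = \<beta> (i + int c * q)" by (rule assms(1))
  then show ?case using Suc by (simp add: algebra_simps)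
qed simp

lemma eventually_period_mod:
  fixes \<beta> :: "int \<Rightarrow> 'b"
  assumes "\<And>i. i \<ge> b \<Longrightarrow> \<beta> (i + q) = \<beta> i" "0 < q" "b \<le> i"
  shows "\<beta> i = \<beta> (b + (i - b) mod q)"
proof -
  have "0 \<le> (i - b) div q" using assms by (simp add: pos_imp_zdiv_nonneg_iff)
  then have "i = b + (i - b) mod q + int (nat ((i - b) div q)) * q"
    using div_mult_mod_eq[of "i - b" q] by (simp add: algebra_simps)
  then show ?thesis using iterate_period[of b \<beta> q "b + (i - b) mod q" "nat ((i - b) div q)"] assms by simp
qed

text \<open>Every window of radius \<open>L\<close> of the second sequence occurs in the first one.  For the columns of a
configuration and \<open>L = r\<close> this keeps membership in a shift of finite type.\<close>

definition windows_from :: "int \<Rightarrow> (int \<Rightarrow> 'b) \<Rightarrow> (int \<Rightarrow> 'b) \<Rightarrow> bool" where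
  "windows_from L \<alpha> \<beta> \<longleftrightarrow> (\<forall>i. \<exists>\<tau>. \<forall>k. \<bar>k - i\<bar> \<le> L \<longrightarrow> \<beta> k = \<alpha> (k + \<tau>))"

lemma windows_from_trans:
  assumes "windows_from L \<alpha> \<beta>" "windows_from L \<beta> \<gamma>"
  shows "windows_from L \<alpha> \<gamma>"
  unfolding windows_from_def
proof
  fix i
  obtain \<tau> where \<tau>: "\<And>k. \<bar>k - i\<bar> \<le> L \<Longrightarrow> \<gamma> k = \<beta> (k + \<tau>)"
    using assms(2) unfolding windows_from_def by blast
  obtain \<sigma> where \<sigma>: "\<And>k. \<bar>k - (i + \<tau>)\<bar> \<le> L \<Longrightarrow> \<beta> k = \<alpha> (k + \<sigma>)"
    using assms(1) unfolding windows_from_def by blast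
  have "\<gamma> k = \<alpha> (k + (\<tau> + \<sigma>))" if "\<bar>k - i\<bar> \<le> L" for k
    using \<tau>[OF that] \<sigma>[of "k + \<tau>"] that by (simp add: add.assoc)
  then show "\<exists>\<tau>. \<forall>k. \<bar>k - i\<bar> \<le> L \<longrightarrow> \<gamma> k = \<alpha> (k + \<tau>)" by blast
qed

lemma windows_from_reflect:
  assumes "windows_from L \<alpha> \<beta>"
  shows "windows_from L (\<lambda>i. \<alpha> (- i)) (\<lambda>i. \<beta> (- i))"
  unfolding windows_from_def
proof
  fix i
  obtain \<tau> where \<tau>: "\<And>k. \<bar>k - (- i)\<bar> \<le> L \<Longrightarrow> \<beta> k = \<alpha> (k + \<tau>)"
    using assms unfolding windows_from_def by blast
  have "\<beta> (- k) = \<alpha> (- (k + (- \<tau>)))" if "\<bar>k - i\<bar> \<le> L" for k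
    using \<tau>[of "- k"] that by (simp add: abs_minus_commute)
  then show "\<exists>\<tau>. \<forall>k. \<bar>k - i\<bar> \<le> L \<longrightarrow> \<beta> (- k) = \<alpha> (- (k + \<tau>))" by blast
qed

text \<open>Among \<open>card S ^ (2 * L + 1) + 1\<close> consecutive positions in the tail, two carry the same word of length \<open>2 * L + 1\<close>.
Repeating the segment between them for ever creates no new windows, because the word shared by its two ends is as long as a window.\<close>

lemma eventually_periodic_right:
  fixes \<alpha> :: "int \<Rightarrow> 'b"
  assumes fin: "finite S" and L: "0 \<le> L" and tail: "\<And>i. i \<ge> a \<Longrightarrow> \<alpha> i \<in> S"
  shows "\<exists>\<beta> b q. 1 \<le> q \<and> q \<le> card S ^ nat (2 * L + 1) \<and> (\<forall>i\<le>a. \<beta> i = \<alpha> i) \<and> windows_from L \<alpha> \<beta> \<and>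
     (\<forall>i\<ge>b. \<beta> (i + int q) = \<beta> i) \<and> (\<forall>i\<ge>a. \<beta> i \<in> S)"
proof -
  define M where "M = nat (2 * L + 1)"
  define N where "N = card S ^ M"
  define word where "word i = map (\<lambda>d. \<alpha> (i + int d)) [0..<M]" for i
  define U where "U = {xs. set xs \<subseteq> S \<and> length xs = M}"
  have U: "finite U" "card U = N"
    using finite_lists_length_eq[OF fin] card_lists_length_eq[OF fin] by (auto simp: U_def N_def)
  have "word ` {a..a + int N} \<subseteq> U" using tail by (auto simp: word_def U_def)
  then have "\<not> inj_on word {a..a + int N}"
    using card_inj_on_le[of word "{a..a + int N}" U] U by auto
  then obtain i1 i2 where i: "a \<le> i1" "i1 < i2" "i2 \<le> a + int N" "word i1 = word i2"
    unfolding inj_on_def by (auto simp: neq_iff)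
  have word_eq: "\<alpha> (i1 + int d) = \<alpha> (i2 + int d)" if "d < M" for d
  proof -
    have "word i1 ! d = word i2 ! d" using i by simp
    then show ?thesis using that by (simp add: word_def)
  qed
  define q where "q = nat (i2 - i1)"
  have q: "1 \<le> q" "q \<le> N" "int q = i2 - i1" using i by (auto simp: q_def)
  define \<beta> where "\<beta> i = (if i < i2 then \<alpha> i else \<alpha> (i1 + (i - i1) mod int q))" for i
  have mod: "\<beta> i = \<alpha> (i1 + (i - i1) mod int q)" if "i \<ge> i1" for i
    using that q by (simp add: \<beta>_def)
  have per: "\<beta> (i + int q) = \<beta> i" if "i \<ge> i1" for i
  proof -
    have "(i + int q - i1) mod int q = (i - i1) mod int q"
      using mod_add_self2[of "i - i1" "int q"] by (simp add: algebra_simps)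
    then show ?thesis using mod[of i] mod[of "i + int q"] that q by simp
  qed
  \<comment> \<open>The repetition and the original still agree on the second occurrence of the word.\<close>
  have ext_nat: "d < M \<Longrightarrow> \<beta> (i2 + int d) = \<alpha> (i2 + int d)" for d
  proof (induction d rule: less_induct)
    case (less d)
    have "\<beta> (i2 + int d) = \<beta> (i1 + int d)" using per[of "i1 + int d"] q by (simp add: algebra_simps)
    also have "\<dots> = \<alpha> (i1 + int d)"
    proof (cases "i1 + int d < i2")
      case False
      define c where "c = nat (i1 + int d - i2)"
      have "i1 + int d = i2 + int c" "c < d" using False i by (auto simp: c_def)
      then show ?thesis using less by simp
    qed (simp add: \<beta>_def)
    finally show ?case using word_eq less.prems by simp
  qed
  have ext: "\<beta> k = \<alpha> k" if "k \<le> i2 + 2 * L" for k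
  proof (cases "k < i2")
    case False
    then show ?thesis using ext_nat[of "nat (k - i2)"] that L by (simp add: M_def)
  qed (simp add: \<beta>_def)
  have "windows_from L \<alpha> \<beta>"
    unfolding windows_from_def
  proof
    fix i
    show "\<exists>\<tau>. \<forall>k. \<bar>k - i\<bar> \<le> L \<longrightarrow> \<beta> k = \<alpha> (k + \<tau>)"
    proof (cases "i - L < i1")
      case True
      then have "\<beta> k = \<alpha> (k + 0)" if "\<bar>k - i\<bar> \<le> L" for k using ext[of k] that i by simp
      then show ?thesis by blast
    next
      case False
      define s where "s = i1 + (i - L - i1) mod int q"
      have s: "i1 \<le> s" "s < i2"
        using pos_mod_sign[of "int q" "i - L - i1"] pos_mod_bound[of "int q" "i - L - i1"] q
        unfolding s_def by linarith+
      define m where "m = (i - L - i1) div int q"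
      have m: "0 \<le> m" using False q by (simp add: m_def pos_imp_zdiv_nonneg_iff)
      have i_eq: "i - L = s + m * int q"
        using div_mult_mod_eq[of "i - L - i1" "int q"] unfolding s_def m_def by linarith
      have "\<beta> k = \<alpha> (k + (- (m * int q)))" if k: "\<bar>k - i\<bar> \<le> L" for k
      proof -
        define l where "l = k - m * int q"
        have l: "s \<le> l" "l \<le> s + 2 * L" using k i_eq by (auto simp: l_def)
        have "\<beta> (l + int (nat m) * int q) = \<beta> l"
          by (rule iterate_period[where b = i1]) (use per s l in auto)
        then have "\<beta> k = \<beta> l" using m by (simp add: l_def)
        also have "\<dots> = \<alpha> l" using ext[of l] l s by simp
        finally show ?thesis by (simp add: l_def)
      qed
      then show ?thesis by blast
    qed
  qed
  moreover have "\<beta> i \<in> S" if "i \<ge> a" for i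
  proof (cases "i < i2")
    case False
    then show ?thesis using tail[of "i1 + (i - i1) mod int q"] q i by (simp add: \<beta>_def add_increasing2)
  qed (use tail that in \<open>simp add: \<beta>_def\<close>)
  moreover have "\<forall>i\<le>a. \<beta> i = \<alpha> i" using i by (simp add: \<beta>_def)
  ultimately show ?thesis using per q unfolding N_def M_def by blast
qed

text \<open>The factorial of any bound on the number of words is a multiple of both periods obtained from the previous lemma, so the common period depends on
the number of symbols only, and not on the sequence.\<close>

lemma eventually_periodic_extension:
  fixes \<alpha> :: "int \<Rightarrow> 'b"
  assumes fin: "finite S" and L: "0 \<le> L" and a: "0 \<le> a" and tail: "\<And>i. \<bar>i\<bar> \<ge> a \<Longrightarrow> \<alpha> i \<in> S"
    and n: "card S ^ nat (2 * L + 1) \<le> n" and P: "P = int (fact n)"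
  shows "\<exists>\<beta> b. (\<forall>i. \<bar>i\<bar> \<le> a \<longrightarrow> \<beta> i = \<alpha> i) \<and> windows_from L \<alpha> \<beta> \<and> (\<forall>i. \<bar>i\<bar> \<ge> a \<longrightarrow> \<beta> i \<in> S) \<and>
     (\<forall>i\<ge>b. \<beta> (i + P) = \<beta> i) \<and> (\<forall>i\<le>-b. \<beta> (i - P) = \<beta> i)"
proof -
  have whole: "\<gamma> (i + P) = \<gamma> i" if q: "1 \<le> q" "q \<le> n" and per: "\<forall>i\<ge>b. \<gamma> (i + int q) = \<gamma> i" and "i \<ge> b"
    for q b i and \<gamma> :: "int \<Rightarrow> 'b"
  proof -
    obtain c where c: "(fact n :: nat) = q * c" using dvd_fact[OF q] by blast
    have "P = int c * int q" unfolding P c by simp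
    then show ?thesis using iterate_period[of b \<gamma> "int q" i c] per that by simp
  qed
  have right: "\<alpha> i \<in> S" if "i \<ge> a" for i using that a tail by simp
  obtain \<beta> b q where \<beta>: "1 \<le> q" "q \<le> card S ^ nat (2 * L + 1)" "\<forall>i\<le>a. \<beta> i = \<alpha> i"
     "windows_from L \<alpha> \<beta>" "\<forall>i\<ge>b. \<beta> (i + int q) = \<beta> i" "\<forall>i\<ge>a. \<beta> i \<in> S"
    using eventually_periodic_right[where \<alpha> = \<alpha>, OF fin L right] by blast
  have left: "\<beta> (- i) \<in> S" if "i \<ge> a" for i
    using that a tail[of "- i"] \<beta>(3) by simp
  obtain \<gamma> b' q' where \<gamma>: "1 \<le> q'" "q' \<le> card S ^ nat (2 * L + 1)" "\<forall>i\<le>a. \<gamma> i = \<beta> (- i)"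
     "windows_from L (\<lambda>i. \<beta> (- i)) \<gamma>" "\<forall>i\<ge>b'. \<gamma> (i + int q') = \<gamma> i" "\<forall>i\<ge>a. \<gamma> i \<in> S"
    using eventually_periodic_right[where \<alpha> = "\<lambda>i. \<beta> (- i)", OF fin L left] by blast
  define \<delta> where "\<delta> = (\<lambda>i. \<gamma> (- i))"
  have \<delta>: "\<delta> i = \<beta> i" if "i \<ge> - a" for i using that \<gamma>(3) by (simp add: \<delta>_def)
  have "windows_from L \<beta> \<delta>" using windows_from_reflect[OF \<gamma>(4)] by (simp add: \<delta>_def)
  then have "windows_from L \<alpha> \<delta>" using windows_from_trans \<beta>(4) by blast
  moreover have "\<delta> i = \<alpha> i" if "\<bar>i\<bar> \<le> a" for i using that \<delta> \<beta>(3) by simp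
  moreover have "\<delta> i \<in> S" if "\<bar>i\<bar> \<ge> a" for i
  proof (cases "i \<ge> a")
    case True then show ?thesis using \<delta>[of i] a \<beta>(6) by simp
  next
    case False then show ?thesis using that \<gamma>(6) a by (simp add: \<delta>_def)
  qed
  moreover have "0 < P" by (simp add: P)
  then have "\<delta> (i + P) = \<delta> i" if "i \<ge> max (max b b') 0" for i
    using whole[OF \<beta>(1) le_trans[OF \<beta>(2) n] \<beta>(5), of i] that a \<delta> by simp
  moreover have "\<delta> (i - P) = \<delta> i" if "i \<le> - max (max b b') 0" for i
    using whole[OF \<gamma>(1) le_trans[OF \<gamma>(2) n] \<gamma>(5), of "- i"] that by (simp add: \<delta>_def)
  ultimately show ?thesis by blast
qed

section \<open>Approximation by points that become finitely supported\<close>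

text \<open>The last assumption is the form in which the compactness of \<open>X\<close> enters the final argument.\<close>

locale gluing_ca = sft_ca X f z r
  for X :: "(int \<times> int \<Rightarrow> 'a) set" and f z r +
  fixes \<Sigma> :: "'a set" and R :: int
  assumes finite_alphabet: "finite \<Sigma>"
    and in_alphabet: "x \<in> X \<Longrightarrow> x h \<in> \<Sigma>"
    and R_pos: "1 \<le> R"
    and glue_columns: "x \<in> X \<Longrightarrow> y \<in> X \<Longrightarrow>
      \<exists>w\<in>X. (\<forall>h. fst h \<le> a \<longrightarrow> w h = x h) \<and> (\<forall>h. fst h \<ge> a + R \<longrightarrow> w h = y h)"
    and glue_rows: "x \<in> X \<Longrightarrow> y \<in> X \<Longrightarrow>
      \<exists>w\<in>X. (\<forall>h. snd h \<le> a \<longrightarrow> w h = x h) \<and> (\<forall>h. snd h \<ge> a + R \<longrightarrow> w h = y h)"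
    and survival_compact: "finite B \<Longrightarrow> (\<And>n. \<exists>x\<in>X. \<forall>t\<le>n. \<exists>h\<in>B. (f ^^ t) x h \<noteq> z) \<Longrightarrow>
      \<exists>x\<in>X. \<forall>t. \<exists>h\<in>B. (f ^^ t) x h \<noteq> z"
begin

text \<open>Glue zero half-planes on the left and on the right, then below and above.  The horizontal seams are infinite, and they are the
only cells where the result is uncontrolled outside a bounded region: the vertical seams end at the rows of the second gluing.\<close>

lemma zero_frame:
  assumes "x \<in> X" "0 \<le> D"
  obtains y where "y \<in> X" "\<And>h. \<bar>fst h\<bar> \<le> D \<Longrightarrow> \<bar>snd h\<bar> \<le> D \<Longrightarrow> y h = x h"
    "\<And>h. \<bar>snd h\<bar> \<ge> D + R \<Longrightarrow> y h = z" "\<And>h. \<bar>fst h\<bar> \<ge> D + R \<Longrightarrow> \<bar>snd h\<bar> \<le> D \<Longrightarrow> y h = z"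
proof -
  obtain x1 where x1: "x1 \<in> X" "\<forall>h. fst h \<le> - D - R \<longrightarrow> x1 h = z" "\<forall>h. fst h \<ge> - D \<longrightarrow> x1 h = x h"
    using glue_columns[OF zero_in assms(1), of "- D - R"] by auto
  obtain x2 where x2: "x2 \<in> X" "\<forall>h. fst h \<le> D \<longrightarrow> x2 h = x1 h" "\<forall>h. fst h \<ge> D + R \<longrightarrow> x2 h = z"
    using glue_columns[OF x1(1) zero_in, of D] by auto
  obtain x3 where x3: "x3 \<in> X" "\<forall>h. snd h \<le> - D - R \<longrightarrow> x3 h = z" "\<forall>h. snd h \<ge> - D \<longrightarrow> x3 h = x2 h"
    using glue_rows[OF zero_in x2(1), of "- D - R"] by auto
  obtain x4 where x4: "x4 \<in> X" "\<forall>h. snd h \<le> D \<longrightarrow> x4 h = x3 h" "\<forall>h. snd h \<ge> D + R \<longrightarrow> x4 h = z"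
    using glue_rows[OF x3(1) zero_in, of D] by auto
  show ?thesis
  proof (rule that[OF x4(1)])
    fix h :: "int \<times> int"
    show "x4 h = x h" if "\<bar>fst h\<bar> \<le> D" "\<bar>snd h\<bar> \<le> D"
      using that x1(3) x2(2) x3(3) x4(2) by (simp del: split_paired_All)
    show "x4 h = z" if "\<bar>snd h\<bar> \<ge> D + R"
    proof (cases "snd h \<ge> D + R")
      case False
      then have "snd h \<le> - D - R" "snd h \<le> D" using that R_pos assms(2) by linarith+
      then show ?thesis using x3(2) x4(2) by (simp del: split_paired_All)
    qed (use x4(3) in blast)
    show "x4 h = z" if "\<bar>fst h\<bar> \<ge> D + R" "\<bar>snd h\<bar> \<le> D"
    proof -
      have "x4 h = x2 h" using that x3(3) x4(2) by (simp del: split_paired_All)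
      also have "\<dots> = z"
      proof (cases "fst h \<ge> D + R")
        case False
        then have "fst h \<le> - D - R" "fst h \<le> D" using that R_pos by linarith+
        then show ?thesis using x1(2) x2(2) by (simp del: split_paired_All)
      qed (use x2(3) in blast)
      finally show ?thesis .
    qed
  qed
qed

definition thin_strips :: "int \<Rightarrow> (int \<times> int \<Rightarrow> 'a) set" where
  "thin_strips P = {x \<in> X. shift_by (P, 0) x = x \<and> (\<forall>h. \<not> (0 < snd h \<and> snd h < R) \<longrightarrow> x h = z)}"

lemma hperiodic_mod:
  assumes "shift_by (P, 0) x = x"
  shows "x (i, j) = x (i mod P, j)"
proof -
  have "vperiodic P (swap_axes x)" unfolding vperiodic_def
    using assms swap_axes_shift[of "(P, 0)" x] by simp
  from vperiodic_mod[OF this, of j i] show ?thesis by (simp add: swap_axes_def)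
qed

lemma finite_thin_strips:
  assumes "0 < P"
  shows "finite (thin_strips P)"
proof -
  define F where "F = {0..<P} \<times> {0<..<R}"
  have "inj_on (\<lambda>x. restrict x F) (thin_strips P)"
  proof (rule inj_onI)
    fix x y assume x: "x \<in> thin_strips P" and y: "y \<in> thin_strips P" and eq: "restrict x F = restrict y F"
    have "x (i, j) = y (i, j)" for i j
    proof (cases "0 < j \<and> j < R")
      case True
      then have "(i mod P, j) \<in> F" using assms by (simp add: F_def)
      then have "x (i mod P, j) = y (i mod P, j)" using fun_cong[OF eq, of "(i mod P, j)"] by simp
      then show ?thesis
        using hperiodic_mod[of P x i j] hperiodic_mod[of P y i j] x y by (simp add: thin_strips_def)
    qed (use x y in \<open>simp add: thin_strips_def\<close>)
    then show "x = y" by auto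
  qed
  moreover have "(\<lambda>x. restrict x F) ` thin_strips P \<subseteq> PiE F (\<lambda>_. \<Sigma>)"
    using in_alphabet by (auto simp: thin_strips_def)
  moreover have "finite (PiE F (\<lambda>_. \<Sigma>))"
    using finite_alphabet by (intro finite_PiE) (simp_all add: F_def)
  ultimately show ?thesis by (metis inj_on_finite)
qed

text \<open>Finitely many mortal points have a common time of death; it depends on the height \<open>R\<close> and the period \<open>P\<close> only.\<close>

lemma thin_strips_die:
  assumes "0 < P"
  shows "\<exists>N. \<forall>x\<in>thin_strips P. (f ^^ N) x = (\<lambda>_. z)"
proof -
  have "mortal x" if x: "x \<in> thin_strips P" for x
  proof (rule hperiodic_mortal[where a = R])
    fix h :: "int \<times> int" assume "\<bar>snd h\<bar> > R"
    then have "\<not> (0 < snd h \<and> snd h < R)" by linarith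
    then show "x h = z" using x unfolding thin_strips_def by blast
  qed (use x assms in \<open>auto simp: thin_strips_def\<close>)
  then obtain n where n: "\<And>x. x \<in> thin_strips P \<Longrightarrow> (f ^^ n x) x = (\<lambda>_. z)"
    unfolding mortal_def by metis
  have "(f ^^ Max (n ` thin_strips P)) x = (\<lambda>_. z)" if "x \<in> thin_strips P" for x
    using iter_zero_mono[OF n[OF that]] finite_thin_strips[OF assms] that by simp
  then show ?thesis by blast
qed

text \<open>Far out in the horizontal direction, \<open>y\<close> looks like the periodic configuration with columns \<open>y (\<rho> k, _)\<close>.  That configuration
consists of two thin strips, one above and one below, which are too far apart to interact within \<open>N\<close> steps; a given
cell sees at most one of them.  The sign \<open>\<sigma>\<close> selects the half on which the cell lies.\<close>

lemma strip_end_dies: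
  assumes N: "\<forall>x\<in>thin_strips P. (f ^^ N) x = (\<lambda>_. z)"
    and D: "2 * r \<le> D" "r * int N \<le> D"
    and y: "y \<in> X"
    and per: "\<And>k. \<rho> (k + P) = \<rho> k"
    and win: "\<And>k0. \<exists>\<tau>. \<forall>k. \<bar>k - k0\<bar> \<le> r \<longrightarrow> (\<forall>l. y (\<rho> k, l) = y (k + \<tau>, l))"
    and thin: "\<And>k l. \<not> (D < \<bar>l\<bar> \<and> \<bar>l\<bar> < D + R) \<Longrightarrow> y (\<rho> k, l) = z"
    and same: "\<And>k l. \<bar>k - i\<bar> \<le> r * int N \<Longrightarrow> y (\<rho> k, l) = y (k, l)"
  shows "(f ^^ N) y (i, j) = z"
proof -
  obtain \<sigma> :: int where \<sigma>: "\<sigma> = 1 \<or> \<sigma> = -1" "0 \<le> \<sigma> * j"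
    using that[of 1] that[of "-1"] by linarith
  define T where "T h = (if \<sigma> * snd h > 0 then y (\<rho> (fst h), snd h) else z)" for h
  have T_y: "T h = y (\<rho> (fst h), snd h)" if "- D \<le> \<sigma> * snd h" for h
    using that \<sigma> thin[of "snd h" "fst h"] by (auto simp: T_def)
  have TX: "T \<in> X"
  proof (rule locally_in)
    fix g :: "int \<times> int"
    show "\<exists>w\<in>X. \<forall>h. near r g h \<longrightarrow> T h = w h"
    proof (cases "- D + r \<le> \<sigma> * snd g")
      case True
      obtain \<tau> where \<tau>: "\<forall>k. \<bar>k - fst g\<bar> \<le> r \<longrightarrow> (\<forall>l. y (\<rho> k, l) = y (k + \<tau>, l))" using win by blast
      have "T h = shift_by (- \<tau>, 0) y h" if "near r g h" for h
      proof -
        have "- D \<le> \<sigma> * snd h" using that True \<sigma>(1) by (auto simp: near_def)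
        then show ?thesis using T_y[of h] \<tau> that by (cases h) (simp add: near_def shift_by_def)
      qed
      then show ?thesis using shift_in[OF y] by blast
    next
      case False
      have "T h = z" if "near r g h" for h
        using that False \<sigma>(1) D(1) by (auto simp: near_def T_def)
      then show ?thesis by (intro bexI[OF _ zero_in]) blast
    qed
  qed
  \<comment> \<open>Moves the chosen strip to the rows strictly between \<open>0\<close> and \<open>R\<close>.\<close>
  define c where "c = (if \<sigma> = 1 then D else - D - R)"
  have "shift_by (0, - c) T \<in> thin_strips P"
  proof -
    have "\<rho> (k - P) = \<rho> k" for k using per[of "k - P"] by simp
    then have "shift_by (P, 0) (shift_by (0, - c) T) = shift_by (0, - c) T"
      by (auto simp: shift_by_def T_def fun_eq_iff)
    moreover have "shift_by (0, - c) T h = z" if "\<not> (0 < snd h \<and> snd h < R)" for h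
    proof -
      obtain k l where h: "h = (k, l)" by fastforce
      have "T (k, l + c) = z"
        using thin[of "l + c" k] that \<sigma>(1) h R_pos D r_nonneg by (auto simp: T_def c_def)
      then show ?thesis by (simp add: shift_by_def h)
    qed
    ultimately show ?thesis using shift_in[OF TX] by (simp add: thin_strips_def)
  qed
  then have "shift_by (0, - c) ((f ^^ N) T) (i, j - c) = z" using N iter_shift[OF TX, of N] by metis
  then have "(f ^^ N) T (i, j) = z" by (simp add: shift_by_def)
  moreover have "(f ^^ N) y (i, j) = (f ^^ N) T (i, j)"
  proof (rule iter_local[OF y TX])
    fix h assume h: "near (r * int N) (i, j) h"
    have "- D \<le> \<sigma> * snd h" using h \<sigma> D(2) by (auto simp: near_def)
    then show "y h = T h" using T_y[of h] same[of "fst h" "snd h"] h by (simp add: near_def)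
  qed
  ultimately show ?thesis by simp
qed

text \<open>Frame the square \<open>[-D, D] \<times> [-D, D]\<close> of \<open>x\<close> by zeros and read the framed point as a sequence of columns.  Outside the frame the columns are
determined by at most \<open>2 * (R - 1)\<close> symbols, those in the two horizontal seams, so the number of possible columns is bounded independently
of \<open>D\<close>, and so is the period \<open>P\<close> of an eventually periodic extension.  After the common time of death \<open>N\<close> of the periodic
strips only a bounded region can be nonzero.\<close>

lemma finite_support_approximation:
  "\<exists>N. \<forall>x\<in>X. \<forall>D. \<exists>y\<in>X. (\<forall>h. \<bar>fst h\<bar> \<le> D \<longrightarrow> \<bar>snd h\<bar> \<le> D \<longrightarrow> y h = x h) \<and>
     (\<exists>A. \<forall>h. max \<bar>fst h\<bar> \<bar>snd h\<bar> > A \<longrightarrow> (f ^^ N) y h = z)"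
proof -
  define E where "E = PiE {-R..R} (\<lambda>_. \<Sigma>)"
  have E: "finite E" using finite_alphabet by (simp add: E_def finite_PiE)
  define n where "n = card E ^ nat (2 * r + 1)"
  define P where "P = int (fact n)"
  have P: "1 \<le> P" using fact_ge_1[of n, where 'a = int] by (simp add: P_def)
  obtain N where N: "\<forall>x\<in>thin_strips P. (f ^^ N) x = (\<lambda>_. z)" using thin_strips_die[of P] P by auto
  have rN: "0 \<le> r * int N" using r_nonneg by simp
  have "\<exists>y\<in>X. (\<forall>h. \<bar>fst h\<bar> \<le> D0 \<longrightarrow> \<bar>snd h\<bar> \<le> D0 \<longrightarrow> y h = x h) \<and>
     (\<exists>A. \<forall>h. max \<bar>fst h\<bar> \<bar>snd h\<bar> > A \<longrightarrow> (f ^^ N) y h = z)" if x: "x \<in> X" for x D0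
  proof -
    define D where "D = max (max D0 0) (max (2 * r) (r * int N))"
    have D: "0 \<le> D" "2 * r \<le> D" "r * int N \<le> D" "D0 \<le> D" by (auto simp: D_def)
    obtain y0 where y0: "y0 \<in> X" "\<And>h. \<bar>fst h\<bar> \<le> D \<Longrightarrow> \<bar>snd h\<bar> \<le> D \<Longrightarrow> y0 h = x h"
      "\<And>h. \<bar>snd h\<bar> \<ge> D + R \<Longrightarrow> y0 h = z" "\<And>h. \<bar>fst h\<bar> \<ge> D + R \<Longrightarrow> \<bar>snd h\<bar> \<le> D \<Longrightarrow> y0 h = z"
      using zero_frame[OF x D(1)] by blast
    define \<alpha> where "\<alpha> i = (\<lambda>j. y0 (i, j))" for i
    define S where "S = {\<phi> :: int \<Rightarrow> 'a. (\<forall>j. \<phi> j \<in> \<Sigma>) \<and> (\<forall>j. \<not> (D < \<bar>j\<bar> \<and> \<bar>j\<bar> < D + R) \<longrightarrow> \<phi> j = z)}"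
    \<comment> \<open>Coding that removes the dependence on \<open>D\<close>: positive arguments read the upper seam, negative ones the lower seam.\<close>
    define enc where "enc \<phi> = restrict (\<lambda>k. if k > 0 then \<phi> (D + k) else \<phi> (- D + k)) {-R..R}"
      for \<phi> :: "int \<Rightarrow> 'a"
    have enc_inj: "inj_on enc S"
    proof (rule inj_onI)
      fix \<phi> \<psi> assume S: "\<phi> \<in> S" "\<psi> \<in> S" and eq: "enc \<phi> = enc \<psi>"
      have "\<phi> j = \<psi> j" for j
      proof (cases "D < \<bar>j\<bar> \<and> \<bar>j\<bar> < D + R")
        case True
        show ?thesis
        proof (cases "j > 0")
          case pos: True
          then show ?thesis using fun_cong[OF eq, of "j - D"] True by (simp add: enc_def)
        next
          case False
          then show ?thesis using fun_cong[OF eq, of "j + D"] True by (simp add: enc_def)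
        qed
      qed (use S in \<open>auto simp: S_def\<close>)
      then show "\<phi> = \<psi>" by auto
    qed
    have enc_into: "enc ` S \<subseteq> E" by (auto simp: enc_def E_def S_def)
    have finS: "finite S" using inj_on_finite[OF enc_inj enc_into E] .
    have "card S \<le> card E" using card_inj_on_le[OF enc_inj enc_into E] .
    then have cardS: "card S ^ nat (2 * r + 1) \<le> n" unfolding n_def by (rule power_mono) simp
    have tail: "\<alpha> i \<in> S" if "\<bar>i\<bar> \<ge> D + R" for i
      using that y0(3)[of "(i, _)"] y0(4)[of "(i, _)"] in_alphabet[OF y0(1)]
      by (auto simp: \<alpha>_def S_def not_less)
    have "0 \<le> D + R" using D R_pos by simp
    from eventually_periodic_extension[where \<alpha> = \<alpha>, OF finS r_nonneg this tail cardS P_def]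
    obtain \<beta> b where \<beta>: "\<And>i. \<bar>i\<bar> \<le> D + R \<Longrightarrow> \<beta> i = \<alpha> i" "windows_from r \<alpha> \<beta>" "\<And>i. \<bar>i\<bar> \<ge> D + R \<Longrightarrow> \<beta> i \<in> S"
      "\<And>i. i \<ge> b \<Longrightarrow> \<beta> (i + P) = \<beta> i" "\<And>i. i \<le> - b \<Longrightarrow> \<beta> (i - P) = \<beta> i"
      by blast
    define y where "y h = \<beta> (fst h) (snd h)" for h
    have window: "\<exists>\<tau>. \<forall>h. \<bar>fst h - i\<bar> \<le> r \<longrightarrow> y h = y0 (fst h + \<tau>, snd h)" for i
    proof -
      obtain \<tau> where "\<forall>k. \<bar>k - i\<bar> \<le> r \<longrightarrow> \<beta> k = \<alpha> (k + \<tau>)"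
        using \<beta>(2) unfolding windows_from_def by blast
      then show ?thesis by (intro exI[of _ \<tau>]) (auto simp: y_def \<alpha>_def)
    qed
    have yX: "y \<in> X"
    proof (rule locally_in)
      fix g :: "int \<times> int"
      obtain \<tau> where \<tau>: "\<forall>h. \<bar>fst h - fst g\<bar> \<le> r \<longrightarrow> y h = y0 (fst h + \<tau>, snd h)" using window by blast
      have "y h = shift_by (- \<tau>, 0) y0 h" if "near r g h" for h
        using \<tau> that by (cases h) (simp add: near_def shift_by_def)
      then show "\<exists>w\<in>X. \<forall>h. near r g h \<longrightarrow> y h = w h" using shift_in[OF y0(1)] by blast
    qed
    have y_rows: "y h = z" if "\<bar>snd h\<bar> \<ge> D + R" for h
      using window[of "fst h"] y0(3) that r_nonneg by (auto simp del: split_paired_All)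
    define b' where "b' = max b (D + R)"
    have b': "b \<le> b'" "D + R \<le> b'" by (auto simp: b'_def)
    have ends: "(f ^^ N) y (i, j) = z" if i: "\<bar>i\<bar> > b' + r * int N" for i j
    proof -
      obtain s :: int where s: "s = 1 \<or> s = -1" "s * i > b' + r * int N"
        using that[of 1] that[of "-1"] i by linarith
      \<comment> \<open>The sign \<open>s\<close> reflects the left end to the right, so that both ends are treated at once.\<close>
      define \<gamma> where "\<gamma> k = \<beta> (s * k)" for k
      have \<gamma>: "\<gamma> (k + P) = \<gamma> k" if "k \<ge> b'" for k
        using s(1) \<beta>(4)[of k] \<beta>(5)[of "- k"] that b' by (auto simp: \<gamma>_def)
      \<comment> \<open>Folds the line into one period at the end in question.\<close>
      define \<rho> where "\<rho> k = s * (b' + (s * k - b') mod P)" for k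
      have ss: "s * (s * k) = k" for k using s(1) by auto
      have \<beta>\<rho>: "\<beta> (\<rho> k) = \<gamma> (b' + (s * k - b') mod P)" for k by (simp add: \<rho>_def \<gamma>_def)
      have \<gamma>_mod: "\<gamma> k = \<gamma> (b' + (k - b') mod P)" if "k \<ge> b'" for k
        using eventually_period_mod[of b' \<gamma> P k] \<gamma> P that by simp
      show ?thesis
      proof (rule strip_end_dies[OF N D(2,3) yX, of \<rho>])
        show "\<rho> (k + P) = \<rho> k" for k
        proof -
          have "(s * (k + P) - b') mod P = (s * k - b' + s * P) mod P" by (simp add: algebra_simps)
          then show ?thesis by (simp add: \<rho>_def)
        qed
        show "\<exists>\<tau>. \<forall>k. \<bar>k - k0\<bar> \<le> r \<longrightarrow> (\<forall>l. y (\<rho> k, l) = y (k + \<tau>, l))" for k0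
        proof -
          \<comment> \<open>Enough periods to carry the window into the periodic end.\<close>
          define C where "C = \<bar>b'\<bar> + \<bar>k0\<bar> + r"
          have C: "C \<le> C * P" using P r_nonneg by (simp add: C_def mult_le_cancel_left1)
          have "\<beta> (\<rho> k) = \<beta> (k + s * (C * P))" if k: "\<bar>k - k0\<bar> \<le> r" for k
          proof -
            have "s * k + C * P \<ge> b'" using s(1) k C by (auto simp: C_def)
            then have "\<gamma> (s * k + C * P) = \<gamma> (b' + (s * k + C * P - b') mod P)" by (rule \<gamma>_mod)
            also have "(s * k + C * P - b') mod P = (s * k - b') mod P"
              using mod_mult_self1[of "s * k - b'" C P] by (simp add: algebra_simps)
            finally have "\<beta> (\<rho> k) = \<gamma> (s * k + C * P)" by (simp add: \<beta>\<rho>)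
            then show ?thesis by (simp add: \<gamma>_def distrib_left ss)
          qed
          then show ?thesis by (intro exI[of _ "s * (C * P)"]) (simp add: y_def)
        qed
        show "y (\<rho> k, l) = z" if "\<not> (D < \<bar>l\<bar> \<and> \<bar>l\<bar> < D + R)" for k l
        proof -
          have "0 \<le> (s * k - b') mod P" using P by simp
          then have "\<bar>\<rho> k\<bar> \<ge> D + R" using s(1) b' by (auto simp: \<rho>_def)
          then have "\<beta> (\<rho> k) \<in> S" by (rule \<beta>(3))
          then show ?thesis using that by (simp add: S_def y_def)
        qed
        show "y (\<rho> k, l) = y (k, l)" if k: "\<bar>k - i\<bar> \<le> r * int N" for k l
        proof -
          have "s * k \<ge> b'" using s k by auto
          then show ?thesis using \<gamma>_mod[of "s * k"] \<beta>\<rho>[of k] by (simp add: y_def \<gamma>_def ss)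
        qed
      qed
    qed
    have "(f ^^ N) y h = z" if h: "max \<bar>fst h\<bar> \<bar>snd h\<bar> > b' + r * int N" for h
    proof (cases "\<bar>fst h\<bar> > b' + r * int N")
      case True
      then show ?thesis using ends[of "fst h" "snd h"] by simp
    next
      case False
      then have h: "\<bar>snd h\<bar> > b' + r * int N" using h by simp
      show ?thesis
      proof (rule iter_local_zero[OF yX], rule y_rows)
        fix g assume "near (r * int N) h g"
        then show "D + R \<le> \<bar>snd g\<bar>" using h b' by (auto simp: near_def)
      qed
    qed
    moreover have "y h = x h" if "\<bar>fst h\<bar> \<le> D0" "\<bar>snd h\<bar> \<le> D0" for h
      using that D(4) R_pos y0(2)[of h] \<beta>(1)[of "fst h"] by (simp add: y_def \<alpha>_def)
    ultimately show ?thesis using yX by blast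
  qed
  then show ?thesis by blast
qed

section \<open>Nilpotency\<close>

definition finite_support :: "(int \<times> int \<Rightarrow> 'a) \<Rightarrow> bool" where
  "finite_support x \<longleftrightarrow> (\<exists>a. \<forall>h. max \<bar>fst h\<bar> \<bar>snd h\<bar> > a \<longrightarrow> x h = z)"

lemma finite_support_iter:
  assumes x: "x \<in> X" and fin: "finite_support x"
  shows "finite_support ((f ^^ n) x)"
proof -
  obtain a where a: "\<forall>h. max \<bar>fst h\<bar> \<bar>snd h\<bar> > a \<longrightarrow> x h = z"
    using fin unfolding finite_support_def by (elim exE)
  have "(f ^^ n) x h = z" if h: "max \<bar>fst h\<bar> \<bar>snd h\<bar> > a + r * int n" for h
  proof (rule iter_local_zero[OF x])
    fix g assume g: "near (r * int n) h g"
    have "max \<bar>fst h\<bar> \<bar>snd h\<bar> \<le> max \<bar>fst g\<bar> \<bar>snd g\<bar> + r * int n"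
      using lipschitzD[OF lipschitz_max g] by (simp only: abs_le_iff diff_le_eq minus_diff_eq add.commute)
    with h have "a + r * int n < max \<bar>fst g\<bar> \<bar>snd g\<bar> + r * int n" by (rule less_le_trans)
    then have "max \<bar>fst g\<bar> \<bar>snd g\<bar> > a" by (simp only: add_less_cancel_right)
    with a show "x g = z" by blast
  qed
  then show ?thesis unfolding finite_support_def by (intro exI[of _ "a + r * int n"] allI impI)
qed

lemma finite_support_no_spreading:
  "\<exists>S. \<forall>e\<in>X. finite_support e \<longrightarrow> (\<forall>h. max \<bar>fst h\<bar> \<bar>snd h\<bar> \<le> S \<longrightarrow> e h = z) \<longrightarrow> (\<forall>t. (f ^^ t) e (0, 0) = z)"
proof (rule ccontr)
  assume spreading: "\<not> ?thesis"
  show False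
  proof (rule no_mortal_spreading[OF lipschitz_max, of "{(0, 0)}"])
    fix S
    obtain e t where e: "e \<in> X" "finite_support e" "\<forall>h. max \<bar>fst h\<bar> \<bar>snd h\<bar> \<le> S \<longrightarrow> e h = z" "(f ^^ t) e (0, 0) \<noteq> z"
      using spreading by blast
    obtain a where a: "\<And>h. max \<bar>fst h\<bar> \<bar>snd h\<bar> > a \<Longrightarrow> e h = z"
      using e(2) unfolding finite_support_def by blast
    have "mortal e" by (rule finite_support_mortal[OF e(1), of a]) (auto intro: a)
    then show "\<exists>e\<in>X. mortal e \<and> (\<exists>a. \<forall>h. max \<bar>fst h\<bar> \<bar>snd h\<bar> > a \<longrightarrow> e h = z) \<and>
        (\<forall>h. max \<bar>fst h\<bar> \<bar>snd h\<bar> \<le> S \<longrightarrow> e h = z) \<and> (\<exists>t. \<exists>h\<in>{(0, 0)}. (f ^^ t) e h \<noteq> z)"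
      using e(1,3,4) a by blast
  qed simp
qed

text \<open>A point that is nonzero at the origin at time \<open>n + N\<close> is replaced by one that agrees with it on the light cone and whose support is finite
from time \<open>N\<close> on.  If its later orbit vanished on \<open>B\<close> at some time up to \<open>n\<close>, the origin would stay zero from then on.
So there are orbits that survive in \<open>B\<close> for arbitrarily long, and by compactness one that survives for ever.\<close>

theorem uniformly_nilpotent: "\<exists>n. \<forall>x\<in>X. (f ^^ n) x = (\<lambda>_. z)"
proof (rule ccontr)
  assume not_nilpotent: "\<not> ?thesis"
  obtain N where N: "\<And>x D. x \<in> X \<Longrightarrow> \<exists>y\<in>X. (\<forall>h. \<bar>fst h\<bar> \<le> D \<longrightarrow> \<bar>snd h\<bar> \<le> D \<longrightarrow> y h = x h) \<and>
     (\<exists>A. \<forall>h. max \<bar>fst h\<bar> \<bar>snd h\<bar> > A \<longrightarrow> (f ^^ N) y h = z)"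
    using finite_support_approximation by blast
  obtain S where S: "\<And>e t. e \<in> X \<Longrightarrow> finite_support e \<Longrightarrow> (\<And>h. max \<bar>fst h\<bar> \<bar>snd h\<bar> \<le> S \<Longrightarrow> e h = z) \<Longrightarrow>
      (f ^^ t) e (0, 0) = z"
    using finite_support_no_spreading by blast
  define B where "B = {-S..S} \<times> {-S..S}"
  have B: "finite B" "\<And>h. max \<bar>fst h\<bar> \<bar>snd h\<bar> \<le> S \<Longrightarrow> h \<in> B" by (auto simp: B_def)
  have alive: "\<exists>x\<in>X. \<forall>t\<le>n. \<exists>h\<in>B. (f ^^ t) x h \<noteq> z" for n
  proof -
    obtain x0 h0 where x0: "x0 \<in> X" "(f ^^ (n + N)) x0 h0 \<noteq> z" using not_nilpotent by (metis ext)
    define x where "x = shift_by (- h0) x0"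
    have "shift_by (- h0) ((f ^^ (n + N)) x0) (0, 0) \<noteq> z"
      using x0(2) by (simp add: shift_by_def flip: zero_prod_def)
    then have x: "x \<in> X" "(f ^^ (n + N)) x (0, 0) \<noteq> z"
      using x0(1) shift_in iter_shift by (auto simp: x_def)
    obtain y where y: "y \<in> X" "\<And>h. \<bar>fst h\<bar> \<le> r * int (n + N) \<Longrightarrow> \<bar>snd h\<bar> \<le> r * int (n + N) \<Longrightarrow> y h = x h"
      "finite_support ((f ^^ N) y)"
      using N[OF x(1), of "r * int (n + N)"] unfolding finite_support_def by blast
    have "(f ^^ (n + N)) y (0, 0) = (f ^^ (n + N)) x (0, 0)"
      by (rule iter_local[OF y(1) x(1)], rule y(2)) (auto simp: near_def)
    then have visit: "(f ^^ n) ((f ^^ N) y) (0, 0) \<noteq> z" using x(2) by (simp add: funpow_add)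
    have eX: "(f ^^ N) y \<in> X" using iter_in y(1) by blast
    have "\<exists>h\<in>B. (f ^^ t) ((f ^^ N) y) h \<noteq> z" if "t \<le> n" for t
    proof (rule ccontr)
      assume "\<not> ?thesis"
      then have "(f ^^ (n - t)) ((f ^^ t) ((f ^^ N) y)) (0, 0) = z"
        using B(2) by (intro S iter_in eX finite_support_iter y(3)) blast
      then show False using visit iter_split[OF that] by metis
    qed
    then show ?thesis using eX by blast
  qed
  obtain x where x: "x \<in> X" "\<forall>t. \<exists>h\<in>B. (f ^^ t) x h \<noteq> z" using survival_compact[OF B(1) alive] by blast
  then show False using asymptotic_finite[OF x(1) B(1)] by blast
qed

end

section \<open>Compactness\<close>

lemma topspace_config: "topspace (config_topology \<Sigma>) = {x. \<forall>h. x h \<in> \<Sigma>}"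
  by (auto simp: config_topology_def)

lemma compact_space_config: "finite \<Sigma> \<Longrightarrow> compact_space (config_topology \<Sigma>)"
  by (simp add: config_topology_def compact_space_product_topology compact_space_discrete_topology)

lemma cylinder_inside_open:
  assumes "openin (config_topology \<Sigma>) U" "x \<in> U"
  obtains F where "finite F" "\<And>y. (\<And>h. y h \<in> \<Sigma>) \<Longrightarrow> (\<And>h. h \<in> F \<Longrightarrow> y h = x h) \<Longrightarrow> y \<in> U"
proof -
  obtain V where V: "finite {i. V i \<noteq> \<Sigma>}" "x \<in> PiE UNIV V" "PiE UNIV V \<subseteq> U"
    using assms unfolding config_topology_def openin_product_topology_alt by fastforce
  show ?thesis
  proof (rule that[OF V(1)])
    fix y assume y: "\<And>h. y h \<in> \<Sigma>" "\<And>h. h \<in> {i. V i \<noteq> \<Sigma>} \<Longrightarrow> y h = x h"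
    have "y h \<in> V h" for h using y V(2) by (cases "V h = \<Sigma>") auto
    then show "y \<in> U" using V(3) by auto
  qed
qed

lemma openin_cylinder:
  assumes "finite F"
  shows "openin (config_topology \<Sigma>) {y. (\<forall>h. y h \<in> \<Sigma>) \<and> (\<forall>h\<in>F. y h = x h)}"
proof -
  define V where "V h = (if h \<in> F then {x h} \<inter> \<Sigma> else \<Sigma>)" for h
  have "{y. (\<forall>h. y h \<in> \<Sigma>) \<and> (\<forall>h\<in>F. y h = x h)} = PiE UNIV V"
    by (auto simp: V_def PiE_def Pi_def split: if_splits)
  moreover have "finite {h. V h \<noteq> \<Sigma>}"
    by (rule finite_subset[OF _ assms]) (auto simp: V_def)
  ultimately show ?thesis
    by (auto simp: config_topology_def openin_PiE_gen V_def)
qed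

text \<open>The theorem of Curtis, Hedlund and Lyndon in the form needed here: a locally constant function on a compact set of configurations depends on
finitely many coordinates, by covering the set with finitely many cylinders on which the function is constant.\<close>

lemma uniform_dependence_radius:
  assumes fin: "finite \<Sigma>" and X: "closedin (config_topology \<Sigma>) X"
    and op: "\<And>v. openin (subtopology (config_topology \<Sigma>) X) {x \<in> X. g x = v}"
  shows "\<exists>r\<ge>0. \<forall>x\<in>X. \<forall>y\<in>X. (\<forall>h. near r (0, 0) h \<longrightarrow> x h = y h) \<longrightarrow> g x = g y"
proof -
  have X_sub: "\<And>x h. x \<in> X \<Longrightarrow> x h \<in> \<Sigma>"
    using closedin_subset[OF X] by (auto simp: topspace_config)
  have "\<exists>F. finite F \<and> (\<forall>y\<in>X. (\<forall>h\<in>F. y h = x h) \<longrightarrow> g y = g x)" if x: "x \<in> X" for x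
  proof -
    obtain U where U: "openin (config_topology \<Sigma>) U" "{y \<in> X. g y = g x} = U \<inter> X"
      using op[of "g x"] unfolding openin_subtopology by blast
    then have "x \<in> U" using x by blast
    then obtain F where F: "finite F" "\<And>y. (\<And>h. y h \<in> \<Sigma>) \<Longrightarrow> (\<And>h. h \<in> F \<Longrightarrow> y h = x h) \<Longrightarrow> y \<in> U"
      using cylinder_inside_open[OF U(1)] by blast
    have "g y = g x" if "y \<in> X" "\<forall>h\<in>F. y h = x h" for y
    proof -
      have "y \<in> U \<inter> X" using F(2)[of y] that X_sub by simp
      then show ?thesis unfolding U(2)[symmetric] by simp
    qed
    then show ?thesis using F(1) by blast
  qed
  then have "\<forall>x\<in>X. \<exists>F. finite F \<and> (\<forall>y\<in>X. (\<forall>h\<in>F. y h = x h) \<longrightarrow> g y = g x)" by (rule ballI)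
  from bchoice[OF this] obtain F where F: "\<And>x. x \<in> X \<Longrightarrow> finite (F x)"
     "\<And>x y. x \<in> X \<Longrightarrow> y \<in> X \<Longrightarrow> (\<forall>h\<in>F x. y h = x h) \<Longrightarrow> g y = g x" by blast
  define C where "C x = {y. (\<forall>h. y h \<in> \<Sigma>) \<and> (\<forall>h\<in>F x. y h = x h)}" for x
  have compact: "compactin (config_topology \<Sigma>) X"
    using closedin_compact_space[OF compact_space_config[OF fin] X] .
  have "\<exists>\<F>. finite \<F> \<and> \<F> \<subseteq> C ` X \<and> X \<subseteq> \<Union> \<F>"
  proof (rule compactinD[OF compact])
    show "\<And>U. U \<in> C ` X \<Longrightarrow> openin (config_topology \<Sigma>) U"
      using openin_cylinder F(1) by (auto simp: C_def)
    show "X \<subseteq> \<Union> (C ` X)" using X_sub by (auto simp: C_def)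
  qed
  then obtain \<F> where \<F>: "finite \<F>" "\<F> \<subseteq> C ` X" "X \<subseteq> \<Union> \<F>" by blast
  then obtain T where T: "finite T" "T \<subseteq> X" "\<F> = C ` T" by (meson finite_subset_image)
  define G where "G = (\<Union>x\<in>T. F x)"
  have G: "finite G" using T F(1) by (auto simp: G_def)
  define r where "r = Max (insert 0 ((\<lambda>h. max \<bar>fst h\<bar> \<bar>snd h\<bar>) ` G))"
  have r: "near r (0, 0) h" if "h \<in> G" for h
  proof -
    have "max \<bar>fst h\<bar> \<bar>snd h\<bar> \<le> r" unfolding r_def using G that by (intro Max_ge) auto
    then show ?thesis by (simp add: near_def)
  qed
  have "g x = g y" if x: "x \<in> X" and y: "y \<in> X" and eq: "\<forall>h. near r (0, 0) h \<longrightarrow> x h = y h" for x y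
  proof -
    obtain t where t: "t \<in> T" "x \<in> C t" using \<F>(3) T(3) x by blast
    have x_t: "\<forall>h\<in>F t. x h = t h" using t by (simp add: C_def)
    have "near r (0, 0) h" if "h \<in> F t" for h using r that t(1) unfolding G_def by blast
    then have "\<forall>h\<in>F t. y h = t h" using x_t eq by simp
    then show ?thesis using F(2)[of t x] F(2)[of t y] x_t t x y T(2) by auto
  qed
  moreover have "0 \<le> r" unfolding r_def using G by (intro Max_ge) auto
  ultimately show ?thesis by blast
qed

section \<open>Half-planes as blocks\<close>

lemma rectangle_in_translates:
  assumes "l \<le> u + 1" "l' \<le> u' + 1"
  shows "{l..u} \<times> {l'..u'} \<in> rectangle_translates"
proof -
  have "{l..u} \<times> {l'..u'} = (+) (l, l') ` ({0..int (nat (u - l + 1)) - 1} \<times> {0..int (nat (u' - l' + 1)) - 1})"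
    (is "_ = ?R")
  proof (intro equalityI subsetI)
    fix h assume h: "h \<in> {l..u} \<times> {l'..u'}"
    then show "h \<in> ?R"
      by (intro image_eqI[where x = "(fst h - l, snd h - l')"]) auto
  qed (use assms in auto)
  then show ?thesis unfolding rectangle_translates_def by blast
qed

text \<open>Membership in the closure, unfolded: only finitely many cells can be prescribed at a time.\<close>

lemma blocksI:
  assumes "\<And>F. finite F \<Longrightarrow> \<exists>Q\<in>rectangle_translates. \<forall>h\<in>F. h \<in> Q \<longleftrightarrow> h \<in> A"
  shows "A \<in> blocks"
  unfolding blocks_def mem_Collect_eq in_closure_of
proof (intro conjI allI impI)
  show "(\<lambda>h. h \<in> A) \<in> topspace (config_topology UNIV)" by (simp add: topspace_config)
next
  fix T assume T: "(\<lambda>h. h \<in> A) \<in> T \<and> openin (config_topology UNIV) T"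
  then obtain F where F: "finite F" "\<And>y. (\<And>h. h \<in> F \<Longrightarrow> y h = (h \<in> A)) \<Longrightarrow> y \<in> T"
    using cylinder_inside_open[of UNIV T "\<lambda>h. h \<in> A"] by (metis UNIV_I)
  obtain Q where "Q \<in> rectangle_translates" "\<forall>h\<in>F. h \<in> Q \<longleftrightarrow> h \<in> A" using assms F(1) by blast
  then show "\<exists>y. y \<in> (\<lambda>S h. h \<in> S) ` rectangle_translates \<and> y \<in> T"
    using F(2)[of "\<lambda>h. h \<in> Q"] by blast
qed

lemma half_planes_in_blocks:
  "{h. fst h \<le> a} \<in> blocks" "{h. a \<le> fst h} \<in> blocks"
  "{h. snd h \<le> a} \<in> blocks" "{h. a \<le> snd h} \<in> blocks"
proof -
  have bound: "\<exists>M. \<bar>a\<bar> \<le> M \<and> F \<subseteq> {-M..M} \<times> {-M..M}" if F: "finite F" for F :: "(int \<times> int) set"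
  proof -
    define M where "M = Max (insert \<bar>a\<bar> ((\<lambda>h. max \<bar>fst h\<bar> \<bar>snd h\<bar>) ` F))"
    have "max \<bar>fst h\<bar> \<bar>snd h\<bar> \<le> M" if "h \<in> F" for h
      unfolding M_def using F that by (intro Max_ge) auto
    then have "F \<subseteq> {-M..M} \<times> {-M..M}" by fastforce
    moreover have "\<bar>a\<bar> \<le> M" unfolding M_def using F by (intro Max_ge) auto
    ultimately show ?thesis by blast
  qed
  have block: "A \<in> blocks"
    if "\<And>M. \<bar>a\<bar> \<le> M \<Longrightarrow> \<exists>Q\<in>rectangle_translates. \<forall>h\<in>{-M..M} \<times> {-M..M}. h \<in> Q \<longleftrightarrow> h \<in> A" for A
    by (rule blocksI) (use bound that in \<open>meson subsetD\<close>)
  show "{h. fst h \<le> a} \<in> blocks"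
  proof (rule block)
    fix M assume "\<bar>a\<bar> \<le> M"
    then show "\<exists>Q\<in>rectangle_translates. \<forall>h\<in>{-M..M} \<times> {-M..M}. h \<in> Q \<longleftrightarrow> h \<in> {h. fst h \<le> a}"
      by (intro bexI[OF _ rectangle_in_translates[of "-M" a "-M" M]]) auto
  qed
  show "{h. a \<le> fst h} \<in> blocks"
  proof (rule block)
    fix M assume "\<bar>a\<bar> \<le> M"
    then show "\<exists>Q\<in>rectangle_translates. \<forall>h\<in>{-M..M} \<times> {-M..M}. h \<in> Q \<longleftrightarrow> h \<in> {h. a \<le> fst h}"
      by (intro bexI[OF _ rectangle_in_translates[of a M "-M" M]]) auto
  qed
  show "{h. snd h \<le> a} \<in> blocks"
  proof (rule block)
    fix M assume "\<bar>a\<bar> \<le> M"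
    then show "\<exists>Q\<in>rectangle_translates. \<forall>h\<in>{-M..M} \<times> {-M..M}. h \<in> Q \<longleftrightarrow> h \<in> {h. snd h \<le> a}"
      by (intro bexI[OF _ rectangle_in_translates[of "-M" M "-M" a]]) auto
  qed
  show "{h. a \<le> snd h} \<in> blocks"
  proof (rule block)
    fix M assume "\<bar>a\<bar> \<le> M"
    then show "\<exists>Q\<in>rectangle_translates. \<forall>h\<in>{-M..M} \<times> {-M..M}. h \<in> Q \<longleftrightarrow> h \<in> {h. a \<le> snd h}"
      by (intro bexI[OF _ rectangle_in_translates[of "-M" M a M]]) auto
  qed
qed

lemma glue_separated_blocks:
  assumes R: "\<forall>A\<in>blocks. \<forall>B\<in>blocks. enat R \<le> linf_setdist A B \<longrightarrow>
      (\<forall>P \<in> A \<rightarrow>\<^sub>E \<Sigma>. \<forall>Q \<in> B \<rightarrow>\<^sub>E \<Sigma>. valid_pattern X A P \<longrightarrow> valid_pattern X B Q \<longrightarrow>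
        valid_pattern X (A \<union> B) (union_pattern A P B Q))"
    and A: "A \<in> blocks" and B: "B \<in> blocks" and far: "enat R \<le> linf_setdist A B" and AB: "A \<inter> B = {}"
    and X: "\<And>x h. x \<in> X \<Longrightarrow> x h \<in> \<Sigma>" and x: "x \<in> X" and y: "y \<in> X"
  shows "\<exists>w\<in>X. (\<forall>h\<in>A. w h = x h) \<and> (\<forall>h\<in>B. w h = y h)"
proof -
  have "valid_pattern X (A \<union> B) (union_pattern A (restrict x A) B (restrict y B))"
    using X x y by (intro mp[OF bspec[OF bspec[OF R A] B] far, rule_format]) (auto simp: valid_pattern_def)
  then obtain w where w: "w \<in> X" "union_pattern A (restrict x A) B (restrict y B) = restrict w (A \<union> B)"
    unfolding valid_pattern_def by blast
  have "w h = (if h \<in> A then x h else y h)" if "h \<in> A \<union> B" for h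
    using fun_cong[OF w(2), of h] that by (auto simp: union_pattern_def split: if_splits)
  then show ?thesis using w(1) AB by (intro bexI[of _ w]) auto
qed

text \<open>The maximum with \<open>1\<close> keeps the two half-planes disjoint when the gluing distance is \<open>0\<close>.\<close>

lemma separated_half_planes:
  "enat R \<le> linf_setdist {h. fst h \<le> a} {h. a + max 1 (int R) \<le> fst h}"
  "enat R \<le> linf_setdist {h. snd h \<le> a} {h. a + max 1 (int R) \<le> snd h}"
  unfolding linf_setdist_def by (intro INF_greatest; auto simp: linf_dist_def)+

section \<open>Block-gluing shifts of finite type are nil-rigid\<close>

lemma continuous_map_coordinate:
  assumes "continuous_map Y (subtopology (config_topology \<Sigma>) X) F"
  shows "continuous_map Y (discrete_topology \<Sigma>) (\<lambda>x. F x h)"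
  using assms unfolding config_topology_def continuous_map_in_subtopology continuous_map_componentwise_UNIV
  by blast

lemma continuous_map_funpow:
  "continuous_map Y Y F \<Longrightarrow> continuous_map Y Y (F ^^ n)"
  by (induction n) (simp_all add: continuous_map_id continuous_map_compose)

lemma limitin_config_coordinate:
  assumes "limitin (config_topology \<Sigma>) s (\<lambda>_. z) sequentially"
  shows "\<exists>N. \<forall>n\<ge>N. s n h = z"
proof -
  have "limitin (discrete_topology \<Sigma>) (\<lambda>n. s n h) z sequentially"
    using assms unfolding config_topology_def limitin_componentwise by blast
  then have "eventually (\<lambda>n. s n h \<in> {z}) sequentially"
    unfolding limitin_def by (metis empty_subsetI insert_subset insertI1 openin_discrete_topology topspace_discrete_topology)
  then show ?thesis by (simp add: eventually_sequentially)
qed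

text \<open>The points that survive in \<open>B\<close> up to time \<open>n\<close> form a decreasing sequence of nonempty closed sets.\<close>

lemma compactness_of_survival:
  assumes fin: "finite \<Sigma>" and X: "closedin (config_topology \<Sigma>) X" and B: "finite B"
    and cont: "continuous_map (subtopology (config_topology \<Sigma>) X) (subtopology (config_topology \<Sigma>) X) f"
    and alive: "\<And>n. \<exists>x\<in>X. \<forall>t\<le>n. \<exists>h\<in>B. (f ^^ t) x h \<noteq> z"
  shows "\<exists>x\<in>X. \<forall>t. \<exists>h\<in>B. (f ^^ t) x h \<noteq> z"
proof -
  define T where "T = subtopology (config_topology \<Sigma>) X"
  have top: "topspace T = X" using closedin_subset[OF X] by (auto simp: T_def)
  have contT: "continuous_map T (discrete_topology \<Sigma>) (\<lambda>x. (f ^^ t) x h)" for t h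
    using continuous_map_coordinate continuous_map_funpow[OF cont] unfolding T_def by blast
  have compact: "compact_space T"
    unfolding T_def using closedin_compact_space[OF compact_space_config[OF fin] X] compact_space_subtopology by blast
  define C where "C n = {x \<in> X. \<forall>t\<le>n. \<exists>h\<in>B. (f ^^ t) x h \<noteq> z}" for n
  have one: "closedin T {x \<in> X. (f ^^ t) x h \<noteq> z}" for t h
  proof -
    have "closedin T {x \<in> topspace T. (f ^^ t) x h \<in> \<Sigma> - {z}}"
      by (rule closedin_continuous_map_preimage[OF contT]) simp
    moreover have "(f ^^ t) x h \<in> \<Sigma>" if "x \<in> X" for x
      using continuous_map_image_subset_topspace[OF contT[of t h]] that top by auto
    then have "{x \<in> topspace T. (f ^^ t) x h \<in> \<Sigma> - {z}} = {x \<in> X. (f ^^ t) x h \<noteq> z}"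
      using top by auto
    ultimately show ?thesis by simp
  qed
  have "closedin T (\<Inter>t\<in>{..n}. \<Union>h\<in>B. {x \<in> X. (f ^^ t) x h \<noteq> z})" for n
    using one B by (intro closedin_Inter) (auto intro!: closedin_Union)
  moreover have "(\<Inter>t\<in>{..n}. \<Union>h\<in>B. {x \<in> X. (f ^^ t) x h \<noteq> z}) = C n" for n
    by (auto simp: C_def)
  ultimately have "closedin T (C n)" for n by simp
  moreover have "C n \<noteq> {}" for n using alive[of n] by (auto simp: C_def)
  moreover have "decseq C" by (auto simp: C_def decseq_def)
  ultimately have "(\<Inter>n. C n) \<noteq> {}" using compact_space_imp_nest[OF compact] by blast
  then obtain x where "\<And>n. x \<in> C n" by blast
  then show ?thesis unfolding C_def by blast
qed

theorem theorem13p2: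
  fixes \<Sigma> :: "'a set" and z :: 'a and X :: "(int \<times> int \<Rightarrow> 'a) set"
  assumes "finite \<Sigma>" and "z \<in> \<Sigma>"
    and "subshift \<Sigma> X" and "finite_type \<Sigma> X"
    and "block_gluing \<Sigma> X"
    and "(\<lambda>_. z) \<in> X"
  shows "nil_rigid \<Sigma> z X"
  unfolding nil_rigid_def
proof (intro allI impI)
  fix f :: "(int \<times> int \<Rightarrow> 'a) \<Rightarrow> (int \<times> int \<Rightarrow> 'a)"
  assume f: "endomorphism \<Sigma> z X f \<and> asymptotically_nilpotent \<Sigma> z X f"
  have X: "closedin (config_topology \<Sigma>) X" and shift: "\<And>x g. x \<in> X \<Longrightarrow> shift_by g x \<in> X"
    using assms(3) by (auto simp: subshift_def)
  have X_\<Sigma>: "x h \<in> \<Sigma>" if "x \<in> X" for x h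
    using closedin_subset[OF X] that unfolding topspace_config by blast
  have cont: "continuous_map (subtopology (config_topology \<Sigma>) X) (subtopology (config_topology \<Sigma>) X) f"
    and f_shift: "\<And>x g. x \<in> X \<Longrightarrow> f (shift_by g x) = shift_by g (f x)"
    and f_zero: "f (\<lambda>_. z) = (\<lambda>_. z)"
    using f by (auto simp: endomorphism_def)
  have top: "topspace (subtopology (config_topology \<Sigma>) X) = X" using closedin_subset[OF X] by auto
  have f_in: "f x \<in> X" if "x \<in> X" for x
    using continuous_map_image_subset_topspace[OF cont] that top by auto
  \<comment> \<open>The radius of the local rule.\<close>
  obtain r1 where r1: "0 \<le> r1"
    "\<And>x y. x \<in> X \<Longrightarrow> y \<in> X \<Longrightarrow> (\<And>h. near r1 (0, 0) h \<Longrightarrow> x h = y h) \<Longrightarrow> f x (0, 0) = f y (0, 0)"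
  proof -
    have "openin (subtopology (config_topology \<Sigma>) X) {x \<in> X. f x (0, 0) = v}" for v
    proof -
      have "openin (subtopology (config_topology \<Sigma>) X)
          {x \<in> topspace (subtopology (config_topology \<Sigma>) X). f x (0, 0) \<in> {v} \<inter> \<Sigma>}"
        by (rule openin_continuous_map_preimage[OF continuous_map_coordinate[OF cont]]) simp
      moreover have "{x \<in> topspace (subtopology (config_topology \<Sigma>) X). f x (0, 0) \<in> {v} \<inter> \<Sigma>} = {x \<in> X. f x (0, 0) = v}"
        unfolding top using X_\<Sigma>[OF f_in] by auto
      ultimately show ?thesis by simp
    qed
    from uniform_dependence_radius[OF assms(1) X this] show ?thesis using that by blast
  qed
  obtain C where C: "openin (config_topology \<Sigma>) C" "closedin (config_topology \<Sigma>) C"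
    "\<And>x. (\<And>h. x h \<in> \<Sigma>) \<Longrightarrow> x \<in> X \<longleftrightarrow> (\<forall>g. shift_by g x \<in> C)"
    using assms(4) unfolding finite_type_def topspace_config by blast
  \<comment> \<open>The radius of the windows that define \<open>X\<close>.\<close>
  obtain r2 where r2: "0 \<le> r2"
    "\<And>x y. (\<And>h. x h \<in> \<Sigma>) \<Longrightarrow> (\<And>h. y h \<in> \<Sigma>) \<Longrightarrow> (\<And>h. near r2 (0, 0) h \<Longrightarrow> x h = y h) \<Longrightarrow> x \<in> C \<longleftrightarrow> y \<in> C"
  proof -
    let ?S = "topspace (config_topology \<Sigma>)"
    have "openin (subtopology (config_topology \<Sigma>) ?S) {x \<in> ?S. (x \<in> C) = v}" for v
    proof (cases v)
      case True
      then have "{x \<in> ?S. (x \<in> C) = v} = C" using openin_subset[OF C(1)] by auto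
      then show ?thesis using C(1) by simp
    next
      case False
      then have "{x \<in> ?S. (x \<in> C) = v} = ?S - C" by auto
      then show ?thesis using C(2) by (simp add: openin_diff)
    qed
    from uniform_dependence_radius[OF assms(1) closedin_topspace this]
    obtain r where "0 \<le> r" "\<forall>x\<in>?S. \<forall>y\<in>?S. (\<forall>h. near r (0, 0) h \<longrightarrow> x h = y h) \<longrightarrow> (x \<in> C) = (y \<in> C)"
      by blast
    then show ?thesis by (intro that[of r]) (simp_all add: topspace_config)
  qed
  define r where "r = max r1 r2"
  have near_r: "near r1 g h \<Longrightarrow> near r g h" "near r2 g h \<Longrightarrow> near r g h" for g h
    by (auto simp: near_def r_def)
  obtain R where R: "\<forall>A\<in>blocks. \<forall>B\<in>blocks. enat R \<le> linf_setdist A B \<longrightarrow>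
      (\<forall>P \<in> A \<rightarrow>\<^sub>E \<Sigma>. \<forall>Q \<in> B \<rightarrow>\<^sub>E \<Sigma>. valid_pattern X A P \<longrightarrow> valid_pattern X B Q \<longrightarrow>
        valid_pattern X (A \<union> B) (union_pattern A P B Q))"
    using assms(5) unfolding block_gluing_def by (elim exE)
  have ca: "sft_ca X f z r"
  proof (rule sft_ca.intro)
    show "0 \<le> r" using r1 by (simp add: r_def)
    show "(\<lambda>_. z) \<in> X" by (rule assms(6))
    show "shift_by g x \<in> X" if "x \<in> X" for x g by (rule shift[OF that])
    show "f x \<in> X" if "x \<in> X" for x by (rule f_in[OF that])
    show "f (shift_by g x) = shift_by g (f x)" if "x \<in> X" for x g by (rule f_shift[OF that])
    show "f (\<lambda>_. z) = (\<lambda>_. z)" by (rule f_zero)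
    show "x \<in> X" if loc: "\<And>g. \<exists>y\<in>X. \<forall>h. near r g h \<longrightarrow> x h = y h" for x
    proof -
      have x\<Sigma>: "x h \<in> \<Sigma>" for h
      proof -
        obtain y where y: "y \<in> X" "\<forall>i. near r h i \<longrightarrow> x i = y i" using loc by blast
        have "near r h h" using r1(1) by (simp add: near_def r_def)
        then have "x h = y h" using y(2) by blast
        then show ?thesis using X_\<Sigma>[OF y(1)] by simp
      qed
      have "shift_by g x \<in> C" for g
      proof -
        obtain y where y: "y \<in> X" "\<forall>h. near r (- g) h \<longrightarrow> x h = y h" using loc by blast
        have "shift_by g y \<in> C" using C(3)[of y, OF X_\<Sigma>[OF y(1)]] y(1) by blast
        moreover have "shift_by g x \<in> C \<longleftrightarrow> shift_by g y \<in> C"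
        proof (rule r2(2))
          show "shift_by g x h \<in> \<Sigma>" "shift_by g y h \<in> \<Sigma>" for h
            using x\<Sigma> X_\<Sigma>[OF y(1)] by (simp_all only: shift_by_def)
          show "shift_by g x h = shift_by g y h" if "near r2 (0, 0) h" for h
          proof -
            have "near r (- g) (h - g)" using near_r(2)[OF that] by (cases g) (simp add: near_def)
            then have "x (h - g) = y (h - g)" by (rule y(2)[rule_format])
            then show ?thesis by (simp add: shift_by_def)
          qed
        qed
        ultimately show ?thesis by simp
      qed
      then show ?thesis using C(3)[of x, OF x\<Sigma>] by blast
    qed
    show "f x g = f y g" if "x \<in> X" "y \<in> X" "\<And>h. near r g h \<Longrightarrow> x h = y h" for x y g
    proof -
      have "f (shift_by (- g) x) (0, 0) = f (shift_by (- g) y) (0, 0)"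
      proof (rule r1(2)[OF shift shift])
        fix h assume h: "near r1 (0, 0) h"
        have "near r g (h + g)" using near_r(1)[OF h] by (simp add: near_def)
        then show "shift_by (- g) x h = shift_by (- g) y h" using that(3) by (simp add: shift_by_def)
      qed (use that in auto)
      then have "shift_by (- g) (f x) (0, 0) = shift_by (- g) (f y) (0, 0)"
        using f_shift that(1,2) by simp
      then show ?thesis by (simp add: shift_by_def flip: zero_prod_def)
    qed
    show "\<exists>N. \<forall>n\<ge>N. (f ^^ n) x h = z" if "x \<in> X" for x h
    proof (rule limitin_config_coordinate)
      show "limitin (config_topology \<Sigma>) (\<lambda>n. (f ^^ n) x) (\<lambda>_. z) sequentially"
        using f that by (simp add: asymptotically_nilpotent_def)
    qed
  qed
  have gluing: "gluing_ca_axioms X f z \<Sigma> (max 1 (int R))"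
  proof (rule gluing_ca_axioms.intro)
    show "finite \<Sigma>" by (rule assms(1))
    show "x h \<in> \<Sigma>" if "x \<in> X" for x h by (rule X_\<Sigma>[OF that])
    show "1 \<le> max 1 (int R)" by simp
    show "\<exists>w\<in>X. (\<forall>h. fst h \<le> a \<longrightarrow> w h = x h) \<and> (\<forall>h. a + max 1 (int R) \<le> fst h \<longrightarrow> w h = y h)"
      if "x \<in> X" "y \<in> X" for x y a
    proof -
      have "\<exists>w\<in>X. (\<forall>h\<in>{h. fst h \<le> a}. w h = x h) \<and> (\<forall>h\<in>{h. a + max 1 (int R) \<le> fst h}. w h = y h)"
        by (rule glue_separated_blocks[OF R half_planes_in_blocks(1,2) separated_half_planes(1)])
          (use X_\<Sigma> that in auto)
      then show ?thesis by simp
    qed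
    show "\<exists>w\<in>X. (\<forall>h. snd h \<le> a \<longrightarrow> w h = x h) \<and> (\<forall>h. a + max 1 (int R) \<le> snd h \<longrightarrow> w h = y h)"
      if "x \<in> X" "y \<in> X" for x y a
    proof -
      have "\<exists>w\<in>X. (\<forall>h\<in>{h. snd h \<le> a}. w h = x h) \<and> (\<forall>h\<in>{h. a + max 1 (int R) \<le> snd h}. w h = y h)"
        by (rule glue_separated_blocks[OF R half_planes_in_blocks(3,4) separated_half_planes(2)])
          (use X_\<Sigma> that in auto)
      then show ?thesis by simp
    qed
    show "\<exists>x\<in>X. \<forall>t. \<exists>h\<in>B. (f ^^ t) x h \<noteq> z"
      if "finite B" "\<And>n. \<exists>x\<in>X. \<forall>t\<le>n. \<exists>h\<in>B. (f ^^ t) x h \<noteq> z" for B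
      by (rule compactness_of_survival[OF assms(1) X that(1) cont that(2)])
  qed
  obtain n where "\<forall>x\<in>X. (f ^^ n) x = (\<lambda>_. z)"
    using gluing_ca.uniformly_nilpotent[OF gluing_ca.intro[OF ca gluing]] by blast
  then have "(f ^^ n) ` X = {\<lambda>_. z}" using assms(6) by (auto simp: image_iff)
  then show "nilpotent_on z X f" unfolding nilpotent_on_def by blast
qed

end
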